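(* Under the standing assumptions on $\Omega,p,\Psi$ listed in the context, let $\lambda>0$ and let $g\in L^\infty(\Omega)$ satisfy $0\le g\le\lambda$ a.e. on $\Omega$. Define $\mathcal J_\lambda:W^{1,p(x)}(\Omega)\to\mathbb R$ by $$\mathcal J_\lambda(U)=\int_\Omega A(x,\nabla U)\,dx+\frac\lambda2\int_\Omega U^2\,dx-\int_\Omega gU\,dx,$$ and let $X=\{U\in W^{1,p(x)}(\Omega):0\le U\le1\text{ a.e. on }\Omega\}$. Let $V\in X$ be such that $\mathcal J_\lambda(V)=\min_{U\in X}\mathcal J_\lambda(U)$. Then $$\inf_{U\in X}\mathcal J_\lambda(U)=\mathcal J_\lambda(V)=\inf_{U\in W^{1,p(x)}(\Omega)}\mathcal J_\lambda(U).$$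
   Context: Variable exponent spaces: for a measurable bounded $q:\Omega\to[1,\infty)$, $L^{q(x)}(\Omega)$ is the space of measurable $u:\Omega\to\mathbb R$ with $\int_\Omega|u(x)|^{q(x)}dx<\infty$, with the Luxemburg norm $\inf\{t>0:\int_\Omega|u(x)/t|^{q(x)}dx\le1\}$; $W^{1,q(x)}(\Omega)=\{u\in L^{q(x)}(\Omega): |\nabla u|\in L^{q(x)}(\Omega)\}$ (weak gradient) with norm $\|u\|_{L^{q(x)}(\Omega)}+\||\nabla u|\|_{L^{q(x)}(\Omega)}$. Standing assumptions. - $\Omega\subset\mathbb R^N$, $N\ge2$, is an open, bounded, connected Lipschitz domain. - $p:\overline\Omega\to(1,\infty)$ is either log-Hölder continuous (there is $C>0$ with $|p(x)-p(y)|\le C/(-\log|x-y|)$ whenever $0<|x-y|<1/2$) with $p^-:=\min_{\overline\Omega}p\ge\frac{2N}{N+2}$, or continuous with $p^->\frac{2N}{N+2}$. Put $p'(x)=\frac{p(x)}{p(x)-1}$. (In both cases $W^{1,p(x)}(\Omega)$ embeds continuously in $L^2(\Omega)$.) - $\Psi:\overline\Omega\times(0,\infty)\to(0,\infty)$; $\Psi(\cdot,s)$ is measurable for each $s>0$; $\Psi(x,\cdot)$ is locally absolutely continuous on $(0,\infty)$ for a.a. $x\in\Omega$; $\lim_{s\to0^+}\Psi(x,s)s=0$ for each $x\in\Omega$; for a.a. $x\in\Omega$ the function $(0,\infty)\ni s\mapsto\Psi(x,s)s$ is strictly increasing. - $\Phi:\overline\Omega\times\mathbb R\to[0,\infty)$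 is $\Phi(x,s)=\Psi(x,|s|)|s|$ for $s\neq0$, $\Phi(x,0)=0$; $A(x,\xi)=\int_0^{|\xi|}\Phi(x,s)\,ds$ for $\xi\in\mathbb R^N$. - For every $v\in L^{p(x)}(\Omega)$ one has $\Phi(\cdot,v(\cdot))\in L^{p'(x)}(\Omega)$. - There are constants $\delta>0$, $\tilde\delta\ge0$ with $\int_\Omega A(x,\nabla v)\,dx\ge\delta\int_\Omega|\nabla v|^{p(x)}dx-\tilde\delta$ for all $v\in W^{1,p(x)}(\Omega)$. *)

theory Defs
  imports "HOL-Analysis.Analysis"
begin

text \<open>
  Functions on \<open>\<Omega>\<close> are total functions on the ambient space; only their restrictions
  to \<open>\<Omega>\<close> matter, through the measure \<open>lebesgue_on \<Omega>\<close>. Functions that agree almost everywhere are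
  not identified.
\<close>

text \<open>
  Near each boundary point, after a rigid motion, \<open>\<Omega>\<close> is the part of the space above the graph of a
  Lipschitz function. The unit vector \<open>\<nu>\<close> is the vertical direction, and \<open>\<gamma>\<close> is
  evaluated at the orthogonal projection of \<open>x\<close> to the hyperplane orthogonal to \<open>\<nu>\<close>.
\<close>
definition lipschitz_boundary :: "'a::euclidean_space set \<Rightarrow> bool" where
  "lipschitz_boundary \<Omega> \<longleftrightarrow>
     (\<forall>z\<in>frontier \<Omega>. \<exists>r>0. \<exists>\<nu>. norm \<nu> = 1 \<and>
        (\<exists>(\<gamma> :: 'a \<Rightarrow> real) L. L-lipschitz_on {y. y \<bullet> \<nu> = 0} \<gamma> \<and>
           \<Omega> \<inter> ball z r = {x \<in> ball z r. x \<bullet> \<nu> > \<gamma> (x - (x \<bullet> \<nu>) *\<^sub>R \<nu>)}))"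

definition bounded_lipschitz_domain :: "'a::euclidean_space set \<Rightarrow> bool" where
  "bounded_lipschitz_domain \<Omega> \<longleftrightarrow>
     \<Omega> \<noteq> {} \<and> open \<Omega> \<and> bounded \<Omega> \<and> connected \<Omega> \<and> lipschitz_boundary \<Omega>"

definition log_holder_on :: "'a::euclidean_space set \<Rightarrow> ('a \<Rightarrow> real) \<Rightarrow> bool" where
  "log_holder_on S p \<longleftrightarrow>
     (\<exists>C>0. \<forall>x\<in>S. \<forall>y\<in>S. 0 < norm (x - y) \<and> norm (x - y) < 1/2 \<longrightarrow>
        \<bar>p x - p y\<bar> \<le> C / (- ln (norm (x - y))))"

definition absolutely_continuous_on_interval :: "real \<Rightarrow> real \<Rightarrow> (real \<Rightarrow> real) \<Rightarrow> bool" where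
  "absolutely_continuous_on_interval a b f \<longleftrightarrow>
     (\<forall>\<epsilon>>0. \<exists>\<delta>>0. \<forall>(n::nat) (s :: nat \<Rightarrow> real) t.
        (\<forall>i<n. a \<le> s i \<and> s i \<le> t i \<and> t i \<le> b) \<and>
        disjoint_family_on (\<lambda>i. {s i<..<t i}) {..<n} \<and>
        (\<Sum>i<n. t i - s i) < \<delta> \<longrightarrow>
        (\<Sum>i<n. \<bar>f (t i) - f (s i)\<bar>) < \<epsilon>)"

definition locally_absolutely_continuous_on :: "real set \<Rightarrow> (real \<Rightarrow> real) \<Rightarrow> bool" where
  "locally_absolutely_continuous_on S f \<longleftrightarrow>
     (\<forall>a b. a \<le> b \<and> {a..b} \<subseteq> S \<longrightarrow> absolutely_continuous_on_interval a b f)"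

definition L_infty :: "'a::euclidean_space set \<Rightarrow> ('a \<Rightarrow> real) set" where
  "L_infty \<Omega> = {u \<in> borel_measurable (lebesgue_on \<Omega>). \<exists>C. AE x in lebesgue_on \<Omega>. \<bar>u x\<bar> \<le> C}"

definition L_var :: "'a::euclidean_space set \<Rightarrow> ('a \<Rightarrow> real) \<Rightarrow> ('a \<Rightarrow> real) set" where
  "L_var \<Omega> q = {u \<in> borel_measurable (lebesgue_on \<Omega>).
     (\<integral>\<^sup>+x. ennreal (\<bar>u x\<bar> powr q x) \<partial>lebesgue_on \<Omega>) < \<infinity>}"

primrec Ck :: "nat \<Rightarrow> ('a::euclidean_space \<Rightarrow> real) \<Rightarrow> bool" where
  "Ck 0 \<phi> \<longleftrightarrow> continuous_on UNIV \<phi>"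
| "Ck (Suc k) \<phi> \<longleftrightarrow> (\<forall>x. \<phi> differentiable at x) \<and>
     (\<forall>b\<in>Basis. Ck k (\<lambda>x. frechet_derivative \<phi> (at x) b))"

text \<open>The space \<open>C\<^sub>c\<^sup>\<infinity>(\<Omega>)\<close>, its members extended by zero to the whole space.\<close>
definition test_functions :: "'a::euclidean_space set \<Rightarrow> ('a \<Rightarrow> real) set" where
  "test_functions \<Omega> = {\<phi>. (\<forall>k. Ck k \<phi>) \<and>
     compact (closure {x. \<phi> x \<noteq> 0}) \<and> closure {x. \<phi> x \<noteq> 0} \<subseteq> \<Omega>}"

definition locally_integrable ::
    "'a::euclidean_space set \<Rightarrow> ('a \<Rightarrow> 'b::euclidean_space) \<Rightarrow> bool" where
  "locally_integrable \<Omega> u \<longleftrightarrow> (\<forall>K. compact K \<and> K \<subseteq> \<Omega> \<longrightarrow> set_integrable lebesgue K u)"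

definition has_weak_gradient ::
    "'a::euclidean_space set \<Rightarrow> ('a \<Rightarrow> real) \<Rightarrow> ('a \<Rightarrow> 'a) \<Rightarrow> bool" where
  "has_weak_gradient \<Omega> u G \<longleftrightarrow>
     locally_integrable \<Omega> u \<and> locally_integrable \<Omega> G \<and>
     (\<forall>\<phi>\<in>test_functions \<Omega>. \<forall>b\<in>Basis.
        (LINT x|lebesgue_on \<Omega>. u x * frechet_derivative \<phi> (at x) b)
          = - (LINT x|lebesgue_on \<Omega>. (G x \<bullet> b) * \<phi> x))"

text \<open>The weak gradient is unique up to a null set of \<open>\<Omega>\<close>, so the choice is immaterial.\<close>
definition weak_gradient :: "'a::euclidean_space set \<Rightarrow> ('a \<Rightarrow> real) \<Rightarrow> 'a \<Rightarrow> 'a" where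
  "weak_gradient \<Omega> u = (SOME G. has_weak_gradient \<Omega> u G)"

definition W1_var :: "'a::euclidean_space set \<Rightarrow> ('a \<Rightarrow> real) \<Rightarrow> ('a \<Rightarrow> real) set" where
  "W1_var \<Omega> q = {u \<in> L_var \<Omega> q. (\<exists>G. has_weak_gradient \<Omega> u G) \<and>
     (\<lambda>x. norm (weak_gradient \<Omega> u x)) \<in> L_var \<Omega> q}"

definition Phi :: "('a \<Rightarrow> real \<Rightarrow> real) \<Rightarrow> 'a \<Rightarrow> real \<Rightarrow> real" where
  "Phi \<Psi> x s = (if s = 0 then 0 else \<Psi> x \<bar>s\<bar> * \<bar>s\<bar>)"

definition A_fun :: "('a::euclidean_space \<Rightarrow> real \<Rightarrow> real) \<Rightarrow> 'a \<Rightarrow> 'a \<Rightarrow> real" where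
  "A_fun \<Psi> x \<xi> = (LINT s:{0..norm \<xi>}|lborel. Phi \<Psi> x s)"

text \<open>
  Integrals of nonnegative functions are taken with values in \<open>[0,\<infinity>]\<close>, so the functional is formally
  valued in \<^typ>\<open>ereal\<close>. Under the assumptions on \<open>\<Omega>\<close>, \<open>p\<close> and \<open>\<Psi>\<close> in use it is finite on
  \<open>W\<^sup>1\<^sup>,\<^sup>p\<^sup>(\<^sup>x\<^sup>)(\<Omega>)\<close>: the first term because \<open>\<Phi>(\<cdot>,|\<nabla>U|)\<close> lies in the dual space, the second because
  of the embedding into \<open>L\<^sup>2(\<Omega>)\<close>. An infimum in \<^typ>\<open>ereal\<close> is the infimum in the usual sense,
  whereas \<^const>\<open>Inf\<close> on \<^typ>\<open>real\<close> carries no information for a set that is not bounded below.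
\<close>
definition grad_energy :: "'a::euclidean_space set \<Rightarrow> ('a \<Rightarrow> real \<Rightarrow> real) \<Rightarrow> ('a \<Rightarrow> real) \<Rightarrow> ereal" where
  "grad_energy \<Omega> \<Psi> U =
     enn2ereal (\<integral>\<^sup>+x. ennreal (A_fun \<Psi> x (weak_gradient \<Omega> U x)) \<partial>lebesgue_on \<Omega>)"

definition J_fun :: "'a::euclidean_space set \<Rightarrow> ('a \<Rightarrow> real \<Rightarrow> real) \<Rightarrow> real \<Rightarrow> ('a \<Rightarrow> real)
    \<Rightarrow> ('a \<Rightarrow> real) \<Rightarrow> ereal" where
  "J_fun \<Omega> \<Psi> lam g U =
     grad_energy \<Omega> \<Psi> U
     + ereal (lam / 2) * enn2ereal (\<integral>\<^sup>+x. ennreal ((U x)\<^sup>2) \<partial>lebesgue_on \<Omega>)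
     - ereal (LINT x|lebesgue_on \<Omega>. g x * U x)"

definition X_set :: "'a::euclidean_space set \<Rightarrow> ('a \<Rightarrow> real) \<Rightarrow> ('a \<Rightarrow> real) set" where
  "X_set \<Omega> p = {U \<in> W1_var \<Omega> p. AE x in lebesgue_on \<Omega>. 0 \<le> U x \<and> U x \<le> 1}"

end

theory Submission
  imports Defs
begin

text \<open>
  Let \<open>T U = max 0 (min 1 U)\<close>. Then \<open>\<nabla>(T U)\<close> is almost everywhere either \<open>\<nabla>U\<close> or \<open>0\<close>, and
  \<open>A(x,0) = 0 \<le> A(x,\<cdot>)\<close>, so truncation does not increase the gradient term. For \<open>0 \<le> c \<le> \<lambda>\<close> the
  parabola \<open>\<lambda> t\<^sup>2 / 2 - c t\<close> has its vertex \<open>c / \<lambda>\<close> in \<open>[0,1]\<close>, so truncation does not increase the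
  remaining terms either. Hence \<open>J(V) \<le> J(T U) \<le> J(U)\<close> for every \<open>U\<close>. If \<open>\<integral>U\<^sup>2 = \<infinity>\<close>, then
  \<open>J(U) = \<infinity>\<close>, so the embedding into \<open>L\<^sup>2\<close> plays no role.

  The formula for \<open>\<nabla>(T U)\<close> rests on a chain rule for \<open>C\<^sup>1\<close> functions with bounded derivative, which
  holds for mollifications of \<open>U\<close> and passes to the limit by \<open>L\<^sup>1\<close> convergence. The same convergence
  shows that weak gradients are unique, which controls the gradient chosen by \<^const>\<open>weak_gradient\<close>.
\<close>

text \<open>A weak gradient is known only through integrals, so nothing can be differentiated
  pointwise at the start. The way in is that the mollifier kernel centred at \<open>x\<close> is
  itself a test function: inserting it shows that the mollification of \<open>u\<close> has at
  \<open>x\<close> the classical derivative in direction \<open>b\<close> given by the mollification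
  of \<open>G \<bullet> b\<close>, as long as the kernel stays inside \<open>\<Omega>\<close>. Hence
  an explicit smooth kernel is built, and everything is localised to a compact neighbourhood of the
  support of the given test function. Integration by parts for the mollified function then reduces
  to one fact: a directional derivative of a compactly supported function has integral zero. Fubini
  and translation invariance are applied over \<open>lborel\<close>, whereas the definitions speak
  of \<open>lebesgue_on \<Omega>\<close> and of locally integrable functions. Therefore
  \<open>u\<close> and \<open>G \<bullet> b\<close> are cut off to a compact set and replaced by
  Borel functions that agree with them almost everywhere. Truncation has corners at 0 and 1, where
  the C1 chain rule fails; it is reached as a pointwise limit of differences of smoothed positive
  parts.\<close>

subsection \<open>Smooth bump functions\<close>

text \<open>The factor \<open>1 / t ^ j\<close> makes the family closed under differentiation.\<close>
definition flat :: "nat \<Rightarrow> real \<Rightarrow> real" where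
  "flat j t = (if t \<le> 0 then 0 else exp (- 1 / t) / t ^ j)"

lemma flat_nonpos [simp]: "t \<le> 0 \<Longrightarrow> flat j t = 0"
  by (simp add: flat_def)

lemma flat_pos: "0 < t \<Longrightarrow> 0 < flat j t"
  by (simp add: flat_def)

lemma flat_nonneg: "0 \<le> flat j t"
  by (simp add: flat_def)

text \<open>With \<open>y = 1 / t\<close> this is the decay of \<open>y ^ j / exp y\<close> at
  infinity.\<close>

lemma tendsto_flat_at_right_0: "(flat j \<longlongrightarrow> 0) (at_right 0)"
proof -
  have "((\<lambda>t::real. inverse t ^ j / exp (inverse t)) \<longlongrightarrow> 0) (at_right 0)"
    by (rule filterlim_compose[OF tendsto_power_div_exp_0 filterlim_inverse_at_top_right])
  moreover have "\<forall>\<^sub>F t in at_right (0::real). inverse t ^ j / exp (inverse t) = flat j t"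
    unfolding eventually_at_right_field
    by (intro exI[of _ 1]) (auto simp: flat_def exp_minus field_simps)
  ultimately show ?thesis
    by (rule Lim_transform_eventually)
qed

lemma tendsto_flat_0: "(flat j \<longlongrightarrow> 0) (at 0)"
proof -
  have "(flat j \<longlongrightarrow> 0) (at_left 0)"
    by (rule tendsto_eventually) (auto simp: eventually_at_left_field intro: exI[of _ "-1"])
  then show ?thesis
    using tendsto_flat_at_right_0 by (simp add: filterlim_split_at)
qed

text \<open>For \<open>t > 0\<close>, differentiating \<open>exp (- 1 / t)\<close> raises the
  exponent of \<open>1 / t\<close> by two and differentiating \<open>1 / t ^ j\<close> raises it by
  one.\<close>

lemma has_real_derivative_flat:
  "(flat j has_real_derivative flat (j + 2) t - real j * flat (j + 1) t) (at t)"
proof (cases t "0 :: real" rule: linorder_cases)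
  case less
  have "((\<lambda>_. 0) has_real_derivative 0) (at t)"
    by simp
  moreover have "\<forall>\<^sub>F s in nhds t. 0 = flat j s"
    using eventually_nhds_in_open[of "{..<0}" t] less
    by (auto elim!: eventually_mono)
  ultimately have "(flat j has_real_derivative 0) (at t)"
    using DERIV_cong_ev[of t t "\<lambda>_. 0" "flat j" 0 0] by simp
  then show ?thesis
    using less by simp
next
  case equal
  \<comment> \<open>The difference quotient at 0 is again a member of the family, with index
    \<open>j + 1\<close>, on both sides of 0.\<close>
  have "((\<lambda>h. flat j h / h) \<longlongrightarrow> 0) (at 0)"
  proof (rule Lim_transform_eventually[OF tendsto_flat_0[of "j + 1"]])
    show "\<forall>\<^sub>F h in at 0. flat (j + 1) h = flat j h / h"
      by (auto simp: flat_def)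
  qed
  then show ?thesis
    using equal by (simp add: DERIV_def)
next
  case greater
  have "((\<lambda>s. exp (- 1 / s) / s ^ j) has_real_derivative
      flat (j + 2) t - real j * flat (j + 1) t) (at t)"
    using greater
    by (cases j) (auto intro!: derivative_eq_intros simp: flat_def field_simps power2_eq_square,
      metis One_nat_def power_eq_if)
  moreover have "\<forall>\<^sub>F s in nhds t. exp (- 1 / s) / s ^ j = flat j s"
    using eventually_nhds_in_open[of "{0<..}" t] greater
    by (auto elim!: eventually_mono simp: flat_def)
  ultimately show ?thesis
    using DERIV_cong_ev[of t t "\<lambda>s. exp (- 1 / s) / s ^ j" "flat j"] by blast
qed

text \<open>With \<open>s = 1 / t\<close> the claim reads
  \<open>s\<^sup>2 * exp (- s) \<le> 2\<close>, which is the quadratic term of the exponential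
  series. It bounds the derivative of the bump.\<close>

lemma flat_2_le: "flat 2 t \<le> 2"
proof (cases "t \<le> 0")
  case False
  have "(1 / t)\<^sup>2 / 2 \<le> exp (1 / t)"
  proof -
    have "0 < 1 / t" using False by simp
    then show ?thesis using exp_lower_Taylor_quadratic[of "1 / t"] by linarith
  qed
  then have "exp (- (1 / t)) * ((1 / t)\<^sup>2 / 2) \<le> exp (- (1 / t)) * exp (1 / t)"
    by (intro mult_left_mono) auto
  then show ?thesis
    using False by (simp add: flat_def power_divide pos_divide_le_eq mult.commute flip: exp_add)
qed simp

lemma flat_0_le: "flat 0 t \<le> 1"
  by (simp add: flat_def)

section \<open>Closure properties of \<open>Ck\<close>, and the smooth kernel\<close>

lemma Ck_SucI:
  assumes "\<And>x. (f has_derivative D x) (at x)"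
    and "\<And>b. b \<in> Basis \<Longrightarrow> Ck k (\<lambda>x. D x b)"
  shows "Ck (Suc k) f"
proof -
  have "frechet_derivative f (at x) = D x" for x
    using frechet_derivative_at[OF assms(1)] by simp
  then show ?thesis
    using assms by (auto simp: differentiable_def)
qed

lemma Ck_has_derivative:
  "Ck (Suc k) f \<Longrightarrow> (f has_derivative frechet_derivative f (at x)) (at x)"
  using frechet_derivative_works by auto

lemma Ck_SucD: "Ck (Suc k) f \<Longrightarrow> Ck k f"
proof (induction k arbitrary: f)
  case 0
  then show ?case
    by (auto simp: continuous_on_eq_continuous_at differentiable_imp_continuous_within)
next
  case (Suc k)
  then show ?case by auto
qed

lemma Ck_const: "Ck k (\<lambda>_. c)"
proof (induction k arbitrary: c)
  case (Suc k)
  show ?case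
    by (rule Ck_SucI[where D = "\<lambda>_ _. 0"]) (use Suc in auto)
qed simp

lemma Ck_bounded_linear:
  assumes "bounded_linear f"
  shows "Ck k f"
proof (cases k)
  case 0
  then show ?thesis using assms by (simp add: linear_continuous_on)
next
  case (Suc k)
  show ?thesis unfolding Suc
    by (rule Ck_SucI[where D = "\<lambda>_. f"])
       (use assms in \<open>auto simp: Ck_const bounded_linear_imp_has_derivative\<close>)
qed

lemma Ck_add: "Ck k f \<Longrightarrow> Ck k g \<Longrightarrow> Ck k (\<lambda>x. f x + g x)"
proof (induction k arbitrary: f g)
  case 0
  then show ?case by (auto intro: continuous_intros)
next
  case (Suc k)
  show ?case
    by (rule Ck_SucI, rule has_derivative_add, (rule Ck_has_derivative, rule Suc.prems)+)
       (use Suc in auto)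
qed

lemma Ck_mult: "Ck k f \<Longrightarrow> Ck k g \<Longrightarrow> Ck k (\<lambda>x. f x * g x)"
proof (induction k arbitrary: f g)
  case 0
  then show ?case by (auto intro: continuous_intros)
next
  case (Suc k)
  \<comment> \<open>The product rule leaves one factor undifferentiated in each term, so the
    induction hypothesis also needs the factors themselves at order \<open>k\<close>.\<close>
  have "Ck k f" "Ck k g" using Suc.prems by (blast intro: Ck_SucD)+
  then show ?case
    using Suc
    by - (rule Ck_SucI, rule has_derivative_mult, (rule Ck_has_derivative, assumption)+,
        auto intro!: Ck_add)
qed

text \<open>The standard mollifier kernel before normalisation:
  \<open>exp (- 1 / (r\<^sup>2 - (norm z)\<^sup>2))\<close> inside the ball of radius
  \<open>r\<close>, zero outside. Squaring the norm keeps it smooth at the centre.\<close>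

definition bump :: "real \<Rightarrow> 'a::euclidean_space \<Rightarrow> real" where
  "bump r z = flat 0 (r\<^sup>2 - (norm z)\<^sup>2)"

definition bump_deriv :: "real \<Rightarrow> 'a::euclidean_space \<Rightarrow> 'a \<Rightarrow> real" where
  "bump_deriv r z h = - 2 * (z \<bullet> h) * flat 2 (r\<^sup>2 - (norm z)\<^sup>2)"

lemma has_derivative_flat_comp:
  fixes a :: "'a::euclidean_space"
  shows "((\<lambda>y. flat j (r\<^sup>2 - (norm (y - a))\<^sup>2)) has_derivative
      (\<lambda>h. (-2 * ((y - a) \<bullet> h)) * (flat (j + 2) (r\<^sup>2 - (norm (y - a))\<^sup>2)
         - real j * flat (j + 1) (r\<^sup>2 - (norm (y - a))\<^sup>2)))) (at y)"
proof -
  have "((\<lambda>y. r\<^sup>2 - (norm (y - a))\<^sup>2) has_derivative (\<lambda>h. -2 * ((y - a) \<bullet> h))) (at y)"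
    unfolding power2_norm_eq_inner
    by (auto intro!: derivative_eq_intros simp: inner_commute)
  then show ?thesis
    by (rule DERIV_compose_FDERIV[OF has_real_derivative_flat])
qed

text \<open>Induction on \<open>k\<close> with \<open>j\<close> arbitrary: a derivative is an affine
  function of \<open>y\<close> times a combination of members of the same family with indices
  \<open>j + 1\<close> and \<open>j + 2\<close>.\<close>

lemma Ck_flat_comp: "Ck k (\<lambda>y::'a::euclidean_space. flat j (r\<^sup>2 - (norm (y - a))\<^sup>2))"
proof (induction k arbitrary: j)
  case 0
  show ?case
    by (simp, intro continuous_at_imp_continuous_on ballI,
        rule has_derivative_continuous[OF has_derivative_flat_comp])
next
  case (Suc k)
  have lin: "Ck k (\<lambda>y. - 2 * ((y - a) \<bullet> b))" for b
  proof -
    have "Ck k (\<lambda>y. y \<bullet> b * - 2 + 2 * (a \<bullet> b))"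
      by (intro Ck_add Ck_mult Ck_const Ck_bounded_linear bounded_linear_inner_left)
    then show ?thesis by (simp add: inner_diff_left algebra_simps)
  qed
  have "Ck k (\<lambda>y. flat (j + 2) (r\<^sup>2 - (norm (y - a))\<^sup>2)
     + (- real j) * flat (j + 1) (r\<^sup>2 - (norm (y - a))\<^sup>2))"
    by (intro Ck_add Ck_mult Ck_const Suc)
  then have sub: "Ck k (\<lambda>y. flat (j + 2) (r\<^sup>2 - (norm (y - a))\<^sup>2)
     - real j * flat (j + 1) (r\<^sup>2 - (norm (y - a))\<^sup>2))" by simp
  show ?case
    by (rule Ck_SucI[OF has_derivative_flat_comp]) (intro Ck_mult lin sub)
qed

lemma has_derivative_bump:
  "((\<lambda>y. bump r (y - a)) has_derivative bump_deriv r (y - a)) (at y)"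
  using has_derivative_flat_comp[of 0 r a y]
  by (simp add: bump_def bump_deriv_def[abs_def] algebra_simps numeral_2_eq_2)

lemma bump_eq_0: "0 \<le> r \<Longrightarrow> r \<le> norm z \<Longrightarrow> bump r z = 0"
  by (simp add: bump_def power_mono)

lemma bump_pos: "norm z < r \<Longrightarrow> 0 < bump r z"
  unfolding bump_def by (intro flat_pos) (simp add: power_strict_mono)

lemma bump_nonneg: "0 \<le> bump r z"
  by (simp add: bump_def flat_nonneg)

lemma bump_le_1: "bump r z \<le> 1"
  by (simp add: bump_def flat_0_le)

lemma abs_bump_le_1: "\<bar>bump r z\<bar> \<le> 1"
  using bump_nonneg[of r z] bump_le_1[of r z] by simp

text \<open>The 4 is the factor 2 of the inner derivative times the bound 2 on
  \<open>flat 2\<close>; the factor \<open>r\<close> bounds \<open>norm z\<close> on the support.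
  Uniformity in \<open>z\<close> serves domination under the integral sign.\<close>

lemma abs_bump_deriv_le:
  assumes "0 \<le> r"
  shows "\<bar>bump_deriv r z h\<bar> \<le> 4 * r * norm h"
proof (cases "norm z \<le> r")
  case True
  have "\<bar>z \<bullet> h\<bar> \<le> r * norm h"
    using Cauchy_Schwarz_ineq2[of z h] mult_right_mono[OF True, of "norm h"] by simp
  then have "\<bar>z \<bullet> h\<bar> * flat 2 (r\<^sup>2 - (norm z)\<^sup>2) \<le> (r * norm h) * 2"
    by (intro mult_mono flat_2_le flat_nonneg) (use assms in auto)
  then show ?thesis
    by (simp add: bump_deriv_def abs_mult flat_nonneg)
next
  case False
  then have "r\<^sup>2 \<le> (norm z)\<^sup>2"
    using assms by (intro power_mono) auto
  then show ?thesis
    using assms by (simp add: bump_deriv_def)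
qed

lemma continuous_on_bump: "continuous_on S (bump r)"
  using has_derivative_continuous[OF has_derivative_bump[of r 0]]
  by (auto intro!: continuous_at_imp_continuous_on)

lemma borel_measurable_bump [measurable]: "bump r \<in> borel_measurable borel"
  by (intro borel_measurable_continuous_onI continuous_on_bump)

lemma continuous_on_bump_deriv: "continuous_on S (\<lambda>z::'a::euclidean_space. bump_deriv r z h)"
proof -
  have "isCont (flat 2) t" for t
    by (rule DERIV_isCont[OF has_real_derivative_flat])
  then have "continuous_on UNIV (flat 2)"
    by (auto intro: continuous_at_imp_continuous_on)
  then have "continuous_on S (\<lambda>z::'a. flat 2 (r\<^sup>2 - (norm z)\<^sup>2))"
    by (rule continuous_on_compose2) (auto intro!: continuous_intros)
  then show ?thesis
    unfolding bump_deriv_def by (intro continuous_intros)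
qed

lemma borel_measurable_bump_deriv [measurable]: "(\<lambda>z. bump_deriv r z h) \<in> borel_measurable borel"
  by (intro borel_measurable_continuous_onI continuous_on_bump_deriv)

text \<open>This admits the mollifier kernel as a test function in the definition of the weak
  gradient.\<close>

lemma bump_test_function:
  assumes "0 < r" "cball a r \<subseteq> \<Omega>"
  shows "(\<lambda>y. bump r (y - a)) \<in> test_functions \<Omega>"
proof -
  have "{y. bump r (y - a) \<noteq> 0} \<subseteq> cball a r"
  proof safe
    fix y assume "bump r (y - a) \<noteq> 0"
    then show "y \<in> cball a r"
      using bump_eq_0[of r "y - a"] assms(1)
      by (cases "r \<le> norm (y - a)") (auto simp: dist_norm norm_minus_commute)
  qed
  then have "closure {y. bump r (y - a) \<noteq> 0} \<subseteq> cball a r"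
    by (intro closure_minimal) auto
  moreover have "compact (closure {y. bump r (y - a) \<noteq> 0})"
    using calculation by (meson bounded_cball bounded_subset closed_closure compact_eq_bounded_closed)
  moreover have "Ck k (\<lambda>y. bump r (y - a))" for k
    unfolding bump_def by (rule Ck_flat_comp)
  ultimately show ?thesis
    using assms(2) by (auto simp: test_functions_def)
qed

subsection \<open>Translations and mollification in the mean\<close>

lemma integrable_lborel_translate:
  fixes z :: "'a::euclidean_space" and f :: "'a \<Rightarrow> real"
  assumes "integrable lborel f"
  shows "integrable lborel (\<lambda>x. f (x + z))"
proof -
  have "integrable (distr lborel borel ((+) z)) f"
    using assms by (simp add: lborel_distr_plus)
  then show ?thesis
    by (subst (asm) integrable_distr_eq) (use assms in \<open>auto simp: add.commute\<close>)
qed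

lemma integral_lborel_translate:
  fixes z :: "'a::euclidean_space" and f :: "'a \<Rightarrow> real"
  assumes "f \<in> borel_measurable borel"
  shows "(\<integral>x. f (x + z) \<partial>lborel) = (\<integral>x. f x \<partial>lborel)"
  using assms
  by (subst (2) lborel_distr_plus[of z, symmetric]) (simp add: integral_distr add.commute)

text \<open>Phrased with sequences, the form in which dominated convergence applies.\<close>

definition L1_translation_continuous :: "('a::euclidean_space \<Rightarrow> real) \<Rightarrow> bool" where
  "L1_translation_continuous f \<longleftrightarrow>
     (\<forall>z. z \<longlonglongrightarrow> 0 \<longrightarrow> (\<lambda>n. \<integral>x. \<bar>f (x + z n) - f x\<bar> \<partial>lborel) \<longlonglongrightarrow> 0)"

text \<open>
  Since the translate of \<open>U\<close> has the measure of \<open>U\<close>, the two halves of the symmetric difference are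
  equally large, and the half inside \<open>U\<close> tends to zero by dominated convergence, \<open>U\<close> being open.
\<close>
lemma L1_translation_continuous_indicator_open:
  fixes U :: "'a::euclidean_space set"
  assumes "open U" and fin: "emeasure lborel U < \<infinity>"
  shows "L1_translation_continuous (indicator U)"
  unfolding L1_translation_continuous_def
proof (intro allI impI)
  fix z :: "nat \<Rightarrow> 'a" assume z: "z \<longlonglongrightarrow> 0"
  have [measurable]: "U \<in> sets borel" using assms by simp
  let ?i = "indicator U :: 'a \<Rightarrow> real"
  have iU: "integrable lborel ?i"
    using fin by (intro integrable_real_indicator) auto
  have iT: "integrable lborel (\<lambda>x. ?i (x + z n))" for n
    by (rule integrable_lborel_translate[OF iU])
  have iP: "integrable lborel (\<lambda>x. ?i x * (1 - ?i (x + z n)))" for n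
    by (rule Bochner_Integration.integrable_bound[OF iU]) (auto simp: indicator_def)
  have "(\<lambda>n. \<integral>x. ?i x * (1 - ?i (x + z n)) \<partial>lborel) \<longlonglongrightarrow> (\<integral>x. 0 \<partial>(lborel :: 'a measure))"
  proof (rule integral_dominated_convergence[where w = ?i])
    show "AE x in lborel. (\<lambda>n. ?i x * (1 - ?i (x + z n))) \<longlonglongrightarrow> 0"
    proof (rule AE_I2, cases)
      fix x assume x: "x \<in> U"
      have "(\<lambda>n. x + z n) \<longlonglongrightarrow> x + 0" by (intro tendsto_intros z)
      then have "\<forall>\<^sub>F n in sequentially. x + z n \<in> U"
        using topological_tendstoD[OF _ \<open>open U\<close>] x by fastforce
      then show "(\<lambda>n. ?i x * (1 - ?i (x + z n))) \<longlonglongrightarrow> 0"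
        by (intro tendsto_eventually, elim eventually_mono) simp
    qed auto
  qed (use iU in \<open>auto simp: indicator_def\<close>)
  moreover have "(\<integral>x. \<bar>?i (x + z n) - ?i x\<bar> \<partial>lborel) = 2 * (\<integral>x. ?i x * (1 - ?i (x + z n)) \<partial>lborel)" for n
  proof -
    have "(\<integral>x. \<bar>?i (x + z n) - ?i x\<bar> \<partial>lborel)
        = (\<integral>x. (?i (x + z n) - ?i x) + 2 * (?i x * (1 - ?i (x + z n))) \<partial>lborel)"
      by (rule Bochner_Integration.integral_cong) (auto simp: indicator_def)
    also have "\<dots> = (\<integral>x. ?i (x + z n) \<partial>lborel) - (\<integral>x. ?i x \<partial>lborel)
        + 2 * (\<integral>x. ?i x * (1 - ?i (x + z n)) \<partial>lborel)"
      using iP[of n] iU iT[of n]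
      by (subst Bochner_Integration.integral_add) auto
    finally show ?thesis by (simp add: integral_lborel_translate)
  qed
  ultimately show "(\<lambda>n. \<integral>x. \<bar>?i (x + z n) - ?i x\<bar> \<partial>lborel) \<longlonglongrightarrow> 0"
    using tendsto_mult_right_zero by fastforce
qed

text \<open>An argument with three thirds of \<open>e\<close>: the translate of \<open>f - g\<close>
  has the same L1 norm as \<open>f - g\<close>, so both outer errors are controlled by the
  approximation alone.\<close>

lemma L1_translation_continuous_approx:
  fixes f :: "'a::euclidean_space \<Rightarrow> real"
  assumes f: "integrable lborel f"
    and approx: "\<And>e. 0 < e \<Longrightarrow> \<exists>g. integrable lborel g \<and> (\<integral>x. \<bar>f x - g x\<bar> \<partial>lborel) < e
      \<and> L1_translation_continuous g"
  shows "L1_translation_continuous f"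
  unfolding L1_translation_continuous_def
proof (intro allI impI)
  fix z :: "nat \<Rightarrow> 'a" assume z: "z \<longlonglongrightarrow> 0"
  show "(\<lambda>n. \<integral>x. \<bar>f (x + z n) - f x\<bar> \<partial>lborel) \<longlonglongrightarrow> 0"
  proof (rule tendstoI)
    fix e :: real assume e: "0 < e"
    then obtain g where g: "integrable lborel g" "(\<integral>x. \<bar>f x - g x\<bar> \<partial>lborel) < e / 3"
      "L1_translation_continuous g"
      using approx[of "e / 3"] by auto
    have "(\<lambda>n. \<integral>x. \<bar>g (x + z n) - g x\<bar> \<partial>lborel) \<longlonglongrightarrow> 0"
      using g(3) z by (auto simp: L1_translation_continuous_def)
    then have "\<forall>\<^sub>F n in sequentially. dist (\<integral>x. \<bar>g (x + z n) - g x\<bar> \<partial>lborel) 0 < e / 3"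
      by (rule tendstoD) (use e in simp)
    then show "\<forall>\<^sub>F n in sequentially. dist (\<integral>x. \<bar>f (x + z n) - f x\<bar> \<partial>lborel) 0 < e"
    proof eventually_elim
      case (elim n)
      have d: "integrable lborel (\<lambda>x. \<bar>f x - g x\<bar>)" using f g by auto
      have dT: "integrable lborel (\<lambda>x. \<bar>f (x + z n) - g (x + z n)\<bar>)"
        by (rule integrable_lborel_translate[OF d])
      have ft: "integrable lborel (\<lambda>x. f (x + z n))" and gt: "integrable lborel (\<lambda>x. g (x + z n))"
        using f g by (auto intro: integrable_lborel_translate)
      have "(\<integral>x. \<bar>f (x + z n) - f x\<bar> \<partial>lborel)
          \<le> (\<integral>x. \<bar>f (x + z n) - g (x + z n)\<bar> + \<bar>g (x + z n) - g x\<bar> + \<bar>f x - g x\<bar> \<partial>lborel)"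
        using f g ft gt d dT by (intro integral_mono) auto
      also have "\<dots> = (\<integral>x. \<bar>f (x + z n) - g (x + z n)\<bar> \<partial>lborel)
          + (\<integral>x. \<bar>g (x + z n) - g x\<bar> \<partial>lborel) + (\<integral>x. \<bar>f x - g x\<bar> \<partial>lborel)"
        using f g ft gt d dT by (subst Bochner_Integration.integral_add, auto)+
      also have "(\<integral>x. \<bar>f (x + z n) - g (x + z n)\<bar> \<partial>lborel) = (\<integral>x. \<bar>f x - g x\<bar> \<partial>lborel)"
        using d integral_lborel_translate[of "\<lambda>x. \<bar>f x - g x\<bar>" "z n"] by auto
      finally show ?case
        using elim g(2) by (simp add: integral_nonneg_AE)
    qed
  qed
qed

text \<open>Induction over the construction of integrable functions. Outer regularity reduces
  indicators to open sets, sums follow from the triangle inequality, and limits from approximation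
  in L1.\<close>

lemma integrable_imp_L1_translation_continuous:
  fixes f :: "'a::euclidean_space \<Rightarrow> real"
  assumes "integrable lborel f"
  shows "L1_translation_continuous f"
  using assms
proof (induction rule: integrable_induct)
  case (base A c)
  have A: "A \<in> sets borel" using base by simp
  show ?case
  proof (rule L1_translation_continuous_approx)
    show "integrable lborel (\<lambda>x. indicator A x *\<^sub>R c)"
      using base by (intro integrable_scaleR_left integrable_real_indicator) auto
  next
    fix e :: real assume e: "0 < e"
    \<comment> \<open>The error is multiplied by \<open>\<bar>c\<bar>\<close> later; adding 1 keeps
      the denominator positive for \<open>c = 0\<close>.\<close>
    obtain U where U: "open U" "A \<subseteq> U" "(U - A) \<in> lmeasurable"
        "emeasure lebesgue (U - A) < ennreal (e / (\<bar>c\<bar> + 1))"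
      using sets_lebesgue_outer_open[of A "e / (\<bar>c\<bar> + 1)"] e A by (auto simp: add_pos_nonneg)
    have Ub: "U \<in> sets borel" "U - A \<in> sets borel" using U A by auto
    have em: "emeasure lborel (U - A) < ennreal (e / (\<bar>c\<bar> + 1))"
      using U(4) Ub(2) by simp
    have "emeasure lborel U = emeasure lborel (A \<union> (U - A))"
      using U(2) by (simp add: Un_absorb1)
    also have "\<dots> \<le> emeasure lborel A + emeasure lborel (U - A)"
      using A Ub by (intro emeasure_subadditive) auto
    also have "\<dots> < \<infinity>" using base(2) em by (simp add: less_top order.strict_trans)
    finally have fin: "emeasure lborel U < \<infinity>" .
    have "measure lborel (U - A) < e / (\<bar>c\<bar> + 1)"
      using em e order.strict_trans[OF em ennreal_less_top]
      by (subst (asm) emeasure_eq_ennreal_measure) (auto simp: ennreal_less_iff)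
    then have m: "\<bar>c\<bar> * measure lborel (U - A) < e"
    proof -
      have "\<bar>c\<bar> * measure lborel (U - A) \<le> (\<bar>c\<bar> + 1) * measure lborel (U - A)"
        by (intro mult_right_mono) auto
      also have "\<dots> < e"
        using \<open>measure lborel (U - A) < e / (\<bar>c\<bar> + 1)\<close> by (simp add: pos_less_divide_eq mult.commute)
      finally show ?thesis .
    qed
    have "(\<integral>x. \<bar>indicator A x *\<^sub>R c - indicator U x * c\<bar> \<partial>lborel)
        = (\<integral>x. \<bar>c\<bar> * indicator (U - A) x \<partial>lborel)"
      using U(2) by (intro Bochner_Integration.integral_cong) (auto simp: indicator_def)
    also have "\<dots> = \<bar>c\<bar> * measure lborel (U - A)"
      using Ub by simp
    finally have eq: "(\<integral>x. \<bar>indicator A x *\<^sub>R c - indicator U x * c\<bar> \<partial>lborel) < e"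
      using m by simp
    have "L1_translation_continuous (\<lambda>x. indicator U x * c)"
      unfolding L1_translation_continuous_def
    proof (intro allI impI)
      fix z :: "nat \<Rightarrow> 'a" assume "z \<longlonglongrightarrow> 0"
      then have "(\<lambda>n. \<integral>x. \<bar>indicator U (x + z n) - (indicator U x :: real)\<bar> \<partial>lborel) \<longlonglongrightarrow> 0"
        using L1_translation_continuous_indicator_open[OF U(1) fin]
        by (auto simp: L1_translation_continuous_def)
      then have "(\<lambda>n. \<bar>c\<bar> * (\<integral>x. \<bar>indicator U (x + z n) - (indicator U x :: real)\<bar> \<partial>lborel)) \<longlonglongrightarrow> 0"
        by (rule tendsto_mult_right_zero)
      moreover have "\<bar>indicator U (x + z n) * c - indicator U x * c\<bar>
          = \<bar>c\<bar> * \<bar>indicator U (x + z n) - indicator U x\<bar>" for x n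
        by (simp add: abs_mult[symmetric] algebra_simps)
      ultimately show "(\<lambda>n. \<integral>x. \<bar>indicator U (x + z n) * c - indicator U x * c\<bar> \<partial>lborel) \<longlonglongrightarrow> 0"
        by simp
    qed
    moreover have "integrable lborel (\<lambda>x. indicator U x * c)"
      using fin Ub by (intro integrable_mult_left integrable_real_indicator) auto
    ultimately show "\<exists>g. integrable lborel g \<and> (\<integral>x. \<bar>indicator A x *\<^sub>R c - g x\<bar> \<partial>lborel) < e
        \<and> L1_translation_continuous g"
      using eq by blast
  qed
next
  case (add f g)
  show ?case unfolding L1_translation_continuous_def
  proof (intro allI impI)
    fix z :: "nat \<Rightarrow> 'a" assume z: "z \<longlonglongrightarrow> 0"
    have i: "integrable lborel (\<lambda>x. \<bar>h (x + z n) - h x\<bar>)" if "integrable lborel h" for h :: "'a \<Rightarrow> real" and n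
      using that integrable_lborel_translate[OF that] by auto
    have "(\<lambda>n. (\<integral>x. \<bar>f (x + z n) - f x\<bar> \<partial>lborel) + (\<integral>x. \<bar>g (x + z n) - g x\<bar> \<partial>lborel)) \<longlonglongrightarrow> 0"
      using add z tendsto_add_zero unfolding L1_translation_continuous_def by blast
    moreover have "(\<integral>x. \<bar>f (x + z n) + g (x + z n) - (f x + g x)\<bar> \<partial>lborel)
        \<le> (\<integral>x. \<bar>f (x + z n) - f x\<bar> \<partial>lborel) + (\<integral>x. \<bar>g (x + z n) - g x\<bar> \<partial>lborel)" for n
    proof (subst Bochner_Integration.integral_add[symmetric])
      show "(\<integral>x. \<bar>f (x + z n) + g (x + z n) - (f x + g x)\<bar> \<partial>lborel)
        \<le> (\<integral>x. \<bar>f (x + z n) - f x\<bar> + \<bar>g (x + z n) - g x\<bar> \<partial>lborel)"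
        using add i[of f n] i[of g n] i[of "\<lambda>x. f x + g x" n] by (intro integral_mono) auto
    qed (use add i in auto)
    ultimately show "(\<lambda>n. \<integral>x. \<bar>f (x + z n) + g (x + z n) - (f x + g x)\<bar> \<partial>lborel) \<longlonglongrightarrow> 0"
      by - (rule Lim_null_comparison[OF always_eventually], auto simp: integral_nonneg_AE)
  qed
next
  case (lim f s)
  show ?case
  proof (rule L1_translation_continuous_approx[OF lim.hyps(4)])
    fix e :: real assume e: "0 < e"
    \<comment> \<open>The induction rule supplies
      \<open>\<bar>s i x\<bar> \<le> 2 * \<bar>f x\<bar>\<close>, whence the dominating function
      \<open>3 * \<bar>f x\<bar>\<close>.\<close>
    have "(\<lambda>i. \<integral>x. \<bar>f x - s i x\<bar> \<partial>lborel) \<longlonglongrightarrow> (\<integral>x. 0 \<partial>(lborel :: 'a measure))"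
    proof (rule integral_dominated_convergence[where w = "\<lambda>x. 3 * \<bar>f x\<bar>"])
      show "AE x in lborel. (\<lambda>i. \<bar>f x - s i x\<bar>) \<longlonglongrightarrow> 0"
      proof (rule AE_I2)
        fix x
        have "(\<lambda>i. \<bar>f x - s i x\<bar>) \<longlonglongrightarrow> \<bar>f x - f x\<bar>"
          using lim.hyps(2) by (intro tendsto_intros) auto
        then show "(\<lambda>i. \<bar>f x - s i x\<bar>) \<longlonglongrightarrow> 0" by simp
      qed
      show "AE x in lborel. norm \<bar>f x - s i x\<bar> \<le> 3 * \<bar>f x\<bar>" for i
        using lim.hyps(3)[of _ i] by (intro AE_I2) (auto intro: order_trans[OF abs_triangle_ineq4])
    qed (use lim.hyps(1,4) in auto)
    then have "\<forall>\<^sub>F i in sequentially. dist (\<integral>x. \<bar>f x - s i x\<bar> \<partial>lborel) 0 < e"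
      using tendstoD[OF _ e] by fastforce
    then obtain i where "dist (\<integral>x. \<bar>f x - s i x\<bar> \<partial>lborel) 0 < e"
      by (auto simp: eventually_sequentially)
    then show "\<exists>g. integrable lborel g \<and> (\<integral>x. \<bar>f x - g x\<bar> \<partial>lborel) < e \<and> L1_translation_continuous g"
      using lim.hyps(1) lim.IH by (intro exI[of _ "s i"]) auto
  qed
qed

lemma L1_translation_small:
  fixes f :: "'a::euclidean_space \<Rightarrow> real"
  assumes "integrable lborel f" "0 < e"
  obtains d where "0 < d" "\<And>z. norm z < d \<Longrightarrow> (\<integral>x. \<bar>f (x + z) - f x\<bar> \<partial>lborel) < e"
proof -
  let ?T = "\<lambda>z. \<integral>x. \<bar>f (x + z) - f x\<bar> \<partial>lborel"
  have "(?T \<longlongrightarrow> 0) (at 0)"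
    using integrable_imp_L1_translation_continuous[OF assms(1)]
    unfolding tendsto_at_iff_sequentially L1_translation_continuous_def comp_def by blast
  from LIM_D[OF this assms(2)]
  obtain d where d: "0 < d" "\<forall>z. z \<noteq> 0 \<and> norm (z - 0) < d \<longrightarrow> norm (?T z - 0) < e"
    by blast
  show ?thesis
  proof (rule that[OF d(1)])
    fix z :: 'a assume "norm z < d"
    \<comment> \<open>The filter \<open>at 0\<close> excludes \<open>z = 0\<close>, where the
      integral is 0 anyway.\<close>
    then show "?T z < e" using d(2)[rule_format, of z] assms(2) by (cases "z = 0") simp_all
  qed
qed

section \<open>The normalised kernel and convergence of mollifications in L1\<close>

lemma integrable_bump:
  assumes "0 \<le> r"
  shows "integrable lborel (bump r :: 'a::euclidean_space \<Rightarrow> real)"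
proof (rule Bochner_Integration.integrable_bound)
  show "integrable lborel (indicator (cball 0 r) :: 'a \<Rightarrow> real)"
    using emeasure_compact_finite[OF compact_cball, of "0 :: 'a" r]
    by (intro integrable_real_indicator) auto
  show "AE x in lborel. norm (bump r (x :: 'a)) \<le> norm (indicator (cball 0 r) x :: real)"
    using assms by (intro AE_I2) (auto simp: indicator_def abs_bump_le_1 intro!: bump_eq_0)
qed simp

text \<open>A vanishing integral would make the bump zero almost everywhere, but it is positive on a
  nonempty open ball. The result makes normalisation possible.\<close>

lemma integral_bump_pos:
  assumes "0 < r"
  shows "0 < (\<integral>z. bump r z \<partial>(lborel :: 'a::euclidean_space measure))"
proof -
  let ?I = "\<integral>z. bump r z \<partial>(lborel :: 'a measure)"
  have "?I \<noteq> 0"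
  proof
    assume "?I = 0"
    then have "AE z in lborel. bump r (z :: 'a) = 0"
      using assms by (subst (asm) integral_nonneg_eq_0_iff_AE) (auto simp: integrable_bump bump_nonneg)
    then have "AE z in lborel. z \<notin> ball (0 :: 'a) r"
      by (elim eventually_mono) (use bump_pos[of _ r] in force)
    then have "ball (0 :: 'a) r \<in> null_sets lborel"
      by (subst AE_iff_null_sets) auto
    then have "negligible (ball (0 :: 'a) r)"
      by (simp add: negligible_iff_null_sets null_sets_completionI)
    then show False
      using open_not_negligible[of "ball (0 :: 'a) r"] assms by simp
  qed
  moreover have "0 \<le> ?I" by (intro integral_nonneg_AE) (auto simp: bump_nonneg)
  ultimately show ?thesis by simp
qed

text \<open>Convolution with the normalised kernel, which is even. Written with the kernel centred
  at \<open>x\<close>, its integrand in \<open>y\<close> is a test function times \<open>f\<close>,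
  as the weak gradient identity requires.\<close>

definition mollify :: "real \<Rightarrow> ('a::euclidean_space \<Rightarrow> real) \<Rightarrow> 'a \<Rightarrow> real" where
  "mollify r f x = (\<integral>y. bump r (y - x) * f y \<partial>lborel) / (\<integral>z. bump r z \<partial>(lborel :: 'a measure))"

lemma borel_measurable_mollify [measurable (raw)]:
  assumes [measurable]: "f \<in> borel_measurable borel"
  shows "mollify r f \<in> borel_measurable borel"
  unfolding mollify_def by measurable

text \<open>The difference \<open>mollify r f x - f x\<close> is the average of
  \<open>f (x + z) - f x\<close> against a probability density in \<open>z\<close> supported in the
  ball of radius \<open>r\<close>; Tonelli then moves the integral in \<open>x\<close> inside. The
  nonnegative integral is used because integrability of the mollification is itself deduced from
  this bound.\<close>

lemma mollify_L1_close:
  fixes f :: "'a::euclidean_space \<Rightarrow> real"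
  assumes f: "integrable lborel f" and r: "0 < r"
    and small: "\<And>z. norm z < r \<Longrightarrow> (\<integral>x. \<bar>f (x + z) - f x\<bar> \<partial>lborel) \<le> e"
  shows "(\<integral>\<^sup>+x. ennreal \<bar>mollify r f x - f x\<bar> \<partial>lborel) \<le> ennreal e"
proof -
  have [measurable]: "f \<in> borel_measurable borel" using f by auto
  define c where "c = (\<integral>z. bump r z \<partial>(lborel :: 'a measure))"
  define k where "k z = bump r z / c" for z :: 'a
  have [measurable]: "k \<in> borel_measurable borel" unfolding k_def by measurable
  have c: "0 < c" unfolding c_def by (rule integral_bump_pos[OF r])
  have k0: "0 \<le> k z" for z using c bump_nonneg[of r z] by (simp add: k_def)
  have ki: "integrable lborel k" unfolding k_def using r by (intro integrable_divide integrable_bump) auto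
  have k1: "(\<integral>z. k z \<partial>lborel) = 1" unfolding k_def using c by (simp add: c_def)
  have fi: "integrable lborel (\<lambda>z. f (x + z))" for x
    using integrable_lborel_translate[OF f, of x] by (simp add: add.commute)
  have kf: "integrable lborel (\<lambda>z. k z * f (x + z))" for x
  proof (rule Bochner_Integration.integrable_bound)
    show "integrable lborel (\<lambda>z. 1 / c * f (x + z))" using fi by auto
    show "AE z in lborel. norm (k z * f (x + z)) \<le> norm (1 / c * f (x + z))"
      using c
      by (intro AE_I2)
         (auto simp: k_def abs_mult abs_bump_le_1 intro!: divide_right_mono mult_left_le_one_le)
  qed measurable
  have diff: "mollify r f x - f x = (\<integral>z. k z * (f (x + z) - f x) \<partial>lborel)" for x
  proof -
    have "(\<integral>y. bump r (y - x) * f y \<partial>lborel) = (\<integral>z. bump r ((z + x) - x) * f (z + x) \<partial>lborel)"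
      by (rule integral_lborel_translate[symmetric]) measurable
    then have "mollify r f x = (\<integral>z. k z * f (x + z) \<partial>lborel)"
      unfolding mollify_def k_def by (simp add: c_def add.commute)
    moreover have "f x = (\<integral>z. k z * f x \<partial>lborel)" using k1 by simp
    ultimately show ?thesis
      using kf[of x] ki by (simp add: right_diff_distrib)
  qed
  have "(\<integral>\<^sup>+x. ennreal \<bar>mollify r f x - f x\<bar> \<partial>lborel)
      \<le> (\<integral>\<^sup>+x. (\<integral>\<^sup>+z. ennreal (k z * \<bar>f (x + z) - f x\<bar>) \<partial>lborel) \<partial>lborel)"
  proof (rule nn_integral_mono)
    fix x
    have "integrable lborel (\<lambda>z. k z * (f (x + z) - f x))"
      using kf[of x] ki by (simp add: right_diff_distrib)
    from integral_norm_bound_ennreal[OF this]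
    show "ennreal \<bar>mollify r f x - f x\<bar> \<le> (\<integral>\<^sup>+z. ennreal (k z * \<bar>f (x + z) - f x\<bar>) \<partial>lborel)"
      by (simp add: diff abs_mult k0)
  qed
  also have "\<dots> = (\<integral>\<^sup>+z. (\<integral>\<^sup>+x. ennreal (k z * \<bar>f (x + z) - f x\<bar>) \<partial>lborel) \<partial>lborel)"
    by (rule lborel_pair.Fubini') (simp add: case_prod_beta)
  also have "\<dots> \<le> (\<integral>\<^sup>+z. ennreal (k z) * ennreal e \<partial>lborel)"
  proof (rule nn_integral_mono)
    fix z
    show "(\<integral>\<^sup>+x. ennreal (k z * \<bar>f (x + z) - f x\<bar>) \<partial>lborel) \<le> ennreal (k z) * ennreal e"
    proof (cases "norm z < r")
      case True
      have "integrable lborel (\<lambda>x. \<bar>f (x + z) - f x\<bar>)"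
        using integrable_lborel_translate[OF f, of z] f by auto
      then have "(\<integral>\<^sup>+x. ennreal \<bar>f (x + z) - f x\<bar> \<partial>lborel) = ennreal (\<integral>x. \<bar>f (x + z) - f x\<bar> \<partial>lborel)"
        by (intro nn_integral_eq_integral) auto
      also have "\<dots> \<le> ennreal e" using small[OF True] by (rule ennreal_leI)
      finally show ?thesis
        by (simp add: ennreal_mult k0 nn_integral_cmult mult_left_mono)
    next
      case False
      then show ?thesis using r by (simp add: k_def bump_eq_0)
    qed
  qed
  also have "\<dots> = ennreal e"
    using ki k1 k0 by (simp add: nn_integral_multc nn_integral_eq_integral)
  finally show ?thesis .
qed

lemma mollify_tendsto_L1:
  fixes f :: "'a::euclidean_space \<Rightarrow> real"
  assumes f: "integrable lborel f" and r: "\<And>n. 0 < r n" "r \<longlonglongrightarrow> 0"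
  shows "\<And>n. integrable lborel (mollify (r n) f)"
    and "(\<lambda>n. \<integral>x. \<bar>mollify (r n) f x - f x\<bar> \<partial>lborel) \<longlonglongrightarrow> 0"
proof -
  have [measurable]: "f \<in> borel_measurable borel" using f by auto
  have fin: "integrable lborel (mollify s f)" if s: "0 < s" for s
  proof -
    \<comment> \<open>This crude bound holds for every shift, so the preceding estimate makes
      \<open>mollify s f - f\<close> integrable for every radius.\<close>
    have "(\<integral>x. \<bar>f (x + z) - f x\<bar> \<partial>lborel) \<le> 2 * (\<integral>x. \<bar>f x\<bar> \<partial>lborel)" for z
    proof -
      have t: "integrable lborel (\<lambda>x. \<bar>f (x + z)\<bar>)"
        using integrable_lborel_translate[OF f, of z] by auto
      have "(\<integral>x. \<bar>f (x + z) - f x\<bar> \<partial>lborel) \<le> (\<integral>x. \<bar>f (x + z)\<bar> + \<bar>f x\<bar> \<partial>lborel)"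
        using f integrable_lborel_translate[OF f, of z] by (intro integral_mono) auto
      also have "\<dots> = 2 * (\<integral>x. \<bar>f x\<bar> \<partial>lborel)"
        using f t integral_lborel_translate[of "\<lambda>x. \<bar>f x\<bar>" z] by simp
      finally show ?thesis .
    qed
    then have "(\<integral>\<^sup>+x. ennreal \<bar>mollify s f x - f x\<bar> \<partial>lborel) \<le> ennreal (2 * (\<integral>x. \<bar>f x\<bar> \<partial>lborel))"
      by (intro mollify_L1_close[OF f s])
    then have "integrable lborel (\<lambda>x. mollify s f x - f x)"
      by (intro integrableI_bounded) (auto simp: less_top[symmetric] top_unique)
    from Bochner_Integration.integrable_add[OF this f] show ?thesis by simp
  qed
  then show "\<And>n. integrable lborel (mollify (r n) f)" using r by auto
  show "(\<lambda>n. \<integral>x. \<bar>mollify (r n) f x - f x\<bar> \<partial>lborel) \<longlonglongrightarrow> 0"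
  proof (rule tendstoI)
    fix e :: real assume e: "0 < e"
    obtain d where d: "0 < d" "\<And>z. norm z < d \<Longrightarrow> (\<integral>x. \<bar>f (x + z) - f x\<bar> \<partial>lborel) < e / 2"
      using L1_translation_small[OF f half_gt_zero[OF e]] by metis
    have "\<forall>\<^sub>F n in sequentially. r n < d"
      using order_tendstoD(2)[OF r(2) d(1)] .
    then show "\<forall>\<^sub>F n in sequentially. dist (\<integral>x. \<bar>mollify (r n) f x - f x\<bar> \<partial>lborel) 0 < e"
    proof eventually_elim
      case (elim n)
      have "(\<integral>\<^sup>+x. ennreal \<bar>mollify (r n) f x - f x\<bar> \<partial>lborel) \<le> ennreal (e / 2)"
        by (rule mollify_L1_close[OF f r(1)], rule less_imp_le, rule d(2)) (use elim in linarith)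
      also have "(\<integral>\<^sup>+x. ennreal \<bar>mollify (r n) f x - f x\<bar> \<partial>lborel)
          = ennreal (\<integral>x. \<bar>mollify (r n) f x - f x\<bar> \<partial>lborel)"
        using fin[OF r(1)] f by (intro nn_integral_eq_integral) auto
      finally show ?case using e by (simp add: integral_nonneg_AE)
    qed
  qed
qed

subsection \<open>Uniqueness of the weak gradient\<close>

text \<open>The base point is arbitrary in the assumption, so it can be moved along the line to
  \<open>x + s *\<^sub>R b\<close>.\<close>

lemma line_derivative_shift:
  fixes b :: "'a::real_normed_vector"
  assumes "\<And>x. ((\<lambda>t. \<psi> (x + t *\<^sub>R b)) has_real_derivative \<psi>' x) (at 0)"
  shows "((\<lambda>t. \<psi> (x + t *\<^sub>R b)) has_real_derivative \<psi>' (x + s *\<^sub>R b)) (at s)"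
proof -
  have "((\<lambda>t. \<psi> (x + (t + s) *\<^sub>R b)) has_real_derivative \<psi>' (x + s *\<^sub>R b)) (at 0)"
    using assms[of "x + s *\<^sub>R b"] by (simp add: scaleR_add_left ac_simps)
  then show ?thesis
    using DERIV_shift[of "\<lambda>t. \<psi> (x + t *\<^sub>R b)" "\<psi>' (x + s *\<^sub>R b)" 0 s] by simp
qed

lemma line_derivative_bound:
  fixes b :: "'a::real_normed_vector"
  assumes "\<And>x. ((\<lambda>t. \<psi> (x + t *\<^sub>R b)) has_real_derivative \<psi>' x) (at 0)"
    and "\<And>x. \<bar>\<psi>' x\<bar> \<le> L"
  shows "\<bar>\<psi> (x + h *\<^sub>R b) - \<psi> x\<bar> \<le> L * \<bar>h\<bar>"
proof -
  have "norm (\<psi> (x + h *\<^sub>R b) - \<psi> (x + 0 *\<^sub>R b)) \<le> L * norm (h - 0)"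
    by (rule field_differentiable_bound[where S = UNIV and f = "\<lambda>t. \<psi> (x + t *\<^sub>R b)" and
          f' = "\<lambda>t. \<psi>' (x + t *\<^sub>R b)"])
       (use assms line_derivative_shift[OF assms(1)] in auto)
  then show ?thesis by simp
qed

text \<open>The difference quotients of \<open>\<psi>\<close> integrate to zero by translation invariance.\<close>
lemma integral_line_derivative_eq_0:
  fixes b :: "'a::euclidean_space"
  assumes deriv: "\<And>x. ((\<lambda>t. \<psi> (x + t *\<^sub>R b)) has_real_derivative \<psi>' x) (at 0)"
    and bound: "\<And>x. \<bar>\<psi>' x\<bar> \<le> L"
    and int: "integrable lborel \<psi>"
    and K: "compact K" "\<And>x. x \<notin> K \<Longrightarrow> \<psi> x = 0"
  shows "(\<integral>x. \<psi>' x \<partial>lborel) = 0"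
proof -
  have [measurable]: "\<psi> \<in> borel_measurable borel" using int by auto
  define h where "h n = 1 / (real n + 1)" for n
  have h: "0 < h n" "h n \<le> 1" for n by (auto simp: h_def)
  have h0: "h \<longlonglongrightarrow> 0"
    unfolding h_def using LIMSEQ_inverse_real_of_nat by (simp add: inverse_eq_divide add.commute)
  define q where "q n x = (\<psi> (x + h n *\<^sub>R b) - \<psi> x) / h n" for n x
  have lim: "(\<lambda>n. q n x) \<longlonglongrightarrow> \<psi>' x" for x
  proof -
    have "((\<lambda>t. (\<psi> (x + t *\<^sub>R b) - \<psi> x) / t) \<longlongrightarrow> \<psi>' x) (at 0)"
      using deriv[of x] by (simp add: DERIV_def)
    moreover have "filterlim h (at 0) sequentially"
      using h0 h(1) by (auto simp: filterlim_at less_imp_neq[THEN not_sym])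
    ultimately show ?thesis
      unfolding q_def by (rule filterlim_compose)
  qed
  \<comment> \<open>Since \<open>h n \<le> 1\<close>, every shift has length at most
    \<open>norm b\<close>. All quotients therefore vanish outside this single compact set, which
    yields an integrable majorant.\<close>
  define K2 where "K2 = (\<Union>x\<in>K. cball x (norm b))"
  have K2: "compact K2" unfolding K2_def by (rule compact_minkowski_sum_cball[OF K(1)])
  have [measurable]: "K2 \<in> sets borel" using K2 by (simp add: borel_compact)
  have qb: "\<bar>q n x\<bar> \<le> L" for n x
    using line_derivative_bound[where \<psi> = \<psi> and x = x and h = "h n", OF deriv bound] h(1)[of n]
    by (simp add: q_def abs_divide pos_divide_le_eq)
  have q0: "q n x = 0" if "x \<notin> K2" for n x
  proof -
    have "x \<notin> K" using that by (auto simp: K2_def)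
    moreover have "x + h n *\<^sub>R b \<notin> K"
    proof
      assume "x + h n *\<^sub>R b \<in> K"
      moreover have "h n * norm b \<le> norm b" using h[of n] by (intro mult_left_le_one_le) auto
      then have "x \<in> cball (x + h n *\<^sub>R b) (norm b)"
        using h(1)[of n] by (simp add: dist_norm)
      ultimately show False using that by (auto simp: K2_def)
    qed
    ultimately show ?thesis by (simp add: q_def K)
  qed
  have "(\<lambda>n. \<integral>x. q n x \<partial>lborel) \<longlonglongrightarrow> (\<integral>x. \<psi>' x \<partial>lborel)"
  proof (rule integral_dominated_convergence[where w = "\<lambda>x. L * indicator K2 x"])
    show qm: "q n \<in> borel_measurable lborel" for n unfolding q_def by measurable
    \<comment> \<open>The function \<open>\<psi>'\<close> is given only as a pointwise derivative;
      it is measurable as the limit of the quotients.\<close>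
    show "\<psi>' \<in> borel_measurable lborel"
      by (rule borel_measurable_LIMSEQ_real[where u = q, OF lim qm])
    show "integrable lborel (\<lambda>x. L * indicator K2 x)"
      using emeasure_compact_finite[OF K2]
      by (intro integrable_mult_right integrable_real_indicator) auto
    show "AE x in lborel. norm (q n x) \<le> L * indicator K2 x" for n
      using qb q0 by (intro AE_I2) (auto simp: indicator_def)
  qed (use lim in auto)
  moreover have "(\<integral>x. q n x \<partial>lborel) = 0" for n
    unfolding q_def using int integrable_lborel_translate[OF int, of "h n *\<^sub>R b"]
      integral_lborel_translate[of \<psi> "h n *\<^sub>R b"]
    by simp
  ultimately show ?thesis by (simp add: LIMSEQ_const_iff)
qed

lemma bump_line_derivative:
  fixes b :: "'a::euclidean_space"
  shows "((\<lambda>t. bump r (y - (x + t *\<^sub>R b))) has_real_derivative - bump_deriv r (y - x) b) (at 0)"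
proof -
  have "((\<lambda>z. bump r (z - 0)) has_derivative bump_deriv r (y - x - 0)) (at (y - (x + 0 *\<^sub>R b)))"
    using has_derivative_bump[of r 0 "y - x"] by simp
  moreover have "((\<lambda>t. y - (x + t *\<^sub>R b)) has_derivative (\<lambda>t. - (t *\<^sub>R b))) (at 0)"
    by (auto intro!: derivative_eq_intros)
  ultimately have "((\<lambda>t. bump r (y - (x + t *\<^sub>R b) - 0)) has_derivative
      (\<lambda>t. bump_deriv r (y - x - 0) (- (t *\<^sub>R b)))) (at 0)"
    by (rule has_derivative_compose[rotated])
  then have "((\<lambda>t. bump r (y - (x + t *\<^sub>R b))) has_derivative
      (\<lambda>t. bump_deriv r (y - x) (- (t *\<^sub>R b)))) (at 0)"
    by simp
  then show ?thesis
    by (rule has_derivative_imp_has_field_derivative) (simp add: bump_deriv_def)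
qed

text \<open>Differentiation under the integral: by the mean value bound the difference quotients of
  the kernel are at most \<open>4 * r * norm b\<close>, so
  \<open>4 * r * norm b * \<bar>f y\<bar>\<close> dominates.\<close>

lemma mollify_line_derivative:
  fixes f :: "'a::euclidean_space \<Rightarrow> real"
  assumes f: "integrable lborel f" and r: "0 < r"
  shows "((\<lambda>t. mollify r f (x + t *\<^sub>R b)) has_real_derivative
     - (\<integral>y. bump_deriv r (y - x) b * f y \<partial>lborel) / (\<integral>z. bump r z \<partial>(lborel :: 'a measure))) (at 0)"
proof -
  have [measurable]: "f \<in> borel_measurable borel" using f by auto
  have bf: "integrable lborel (\<lambda>y. bump r (y - x) * f y)" for x
    by (rule Bochner_Integration.integrable_bound[OF f])
       (auto intro!: AE_I2 mult_left_le_one_le simp: abs_mult bump_nonneg bump_le_1)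
  have "((\<lambda>t. \<integral>y. bump r (y - (x + t *\<^sub>R b)) * f y \<partial>lborel) has_real_derivative
      - (\<integral>y. bump_deriv r (y - x) b * f y \<partial>lborel)) (at 0)"
    unfolding DERIV_def tendsto_at_iff_sequentially comp_def
  proof (intro allI impI)
    fix h :: "nat \<Rightarrow> real"
    assume h: "\<forall>i. h i \<in> UNIV - {0}" and h0: "h \<longlonglongrightarrow> 0"
    define q where "q n y = (bump r (y - (x + h n *\<^sub>R b)) - bump r (y - x)) / h n" for n y
    have "(\<lambda>n. \<integral>y. q n y * f y \<partial>lborel) \<longlonglongrightarrow> (\<integral>y. - bump_deriv r (y - x) b * f y \<partial>lborel)"
    proof (rule integral_dominated_convergence[where w = "\<lambda>y. 4 * r * norm b * \<bar>f y\<bar>"])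
      show "AE y in lborel. (\<lambda>n. q n y * f y) \<longlonglongrightarrow> - bump_deriv r (y - x) b * f y"
      proof (rule AE_I2)
        fix y
        have "((\<lambda>t. (bump r (y - (x + t *\<^sub>R b)) - bump r (y - x)) / t) \<longlongrightarrow> - bump_deriv r (y - x) b) (at 0)"
          using bump_line_derivative[of r y x b] by (simp add: DERIV_def)
        moreover have "filterlim h (at 0) sequentially"
          using h0 h by (auto simp: filterlim_at)
        ultimately have "(\<lambda>n. q n y) \<longlonglongrightarrow> - bump_deriv r (y - x) b"
          unfolding q_def by (rule filterlim_compose)
        then show "(\<lambda>n. q n y * f y) \<longlonglongrightarrow> - bump_deriv r (y - x) b * f y"
          by (rule tendsto_mult_right)
      qed
      show "AE y in lborel. norm (q n y * f y) \<le> 4 * r * norm b * \<bar>f y\<bar>" for n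
      proof (rule AE_I2)
        fix y
        have "\<bar>bump r (y - (x + h n *\<^sub>R b)) - bump r (y - x)\<bar> \<le> 4 * r * norm b * \<bar>h n\<bar>"
          using r abs_bump_deriv_le[of r]
          by (intro line_derivative_bound[where \<psi> = "\<lambda>x. bump r (y - x)", OF bump_line_derivative]) simp
        then have "\<bar>q n y\<bar> \<le> 4 * r * norm b"
          using h by (simp add: q_def abs_divide pos_divide_le_eq)
        then show "norm (q n y * f y) \<le> 4 * r * norm b * \<bar>f y\<bar>"
          by (simp add: abs_mult mult_right_mono)
      qed
      show "(\<lambda>y. q n y * f y) \<in> borel_measurable lborel" for n
        unfolding q_def by measurable
    qed (use f in auto)
    moreover have "(\<integral>y. q n y * f y \<partial>lborel) = ((\<integral>y. bump r (y - (x + (0 + h n) *\<^sub>R b)) * f y \<partial>lborel)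
        - (\<integral>y. bump r (y - (x + 0 *\<^sub>R b)) * f y \<partial>lborel)) / h n" for n
      using bf[of "x + h n *\<^sub>R b"] bf[of x]
      by (simp add: q_def left_diff_distrib flip: Bochner_Integration.integral_diff)
    ultimately show "(\<lambda>n. ((\<integral>y. bump r (y - (x + (0 + h n) *\<^sub>R b)) * f y \<partial>lborel)
        - (\<integral>y. bump r (y - (x + 0 *\<^sub>R b)) * f y \<partial>lborel)) / h n)
        \<longlonglongrightarrow> - (\<integral>y. bump_deriv r (y - x) b * f y \<partial>lborel)"
      by simp
  qed
  from DERIV_cdivide[OF this] show ?thesis
    unfolding mollify_def by simp
qed

section \<open>Test functions, Borel representatives and the mollified gradient\<close>

lemma abs_integral_mult_le:
  fixes f k :: "'a \<Rightarrow> real"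
  assumes f: "integrable M f" and k: "k \<in> borel_measurable M" "\<And>y. \<bar>k y\<bar> \<le> C"
  shows "\<bar>\<integral>y. k y * f y \<partial>M\<bar> \<le> C * (\<integral>y. \<bar>f y\<bar> \<partial>M)"
proof -
  have "\<bar>\<integral>y. k y * f y \<partial>M\<bar> \<le> (\<integral>y. \<bar>k y * f y\<bar> \<partial>M)"
    by (rule integral_abs_bound)
  also have "\<dots> \<le> (\<integral>y. C * \<bar>f y\<bar> \<partial>M)"
  proof (rule integral_mono)
    show *: "integrable M (\<lambda>y. C * \<bar>f y\<bar>)" using f by auto
    show le: "\<bar>k y * f y\<bar> \<le> C * \<bar>f y\<bar>" for y
      using k(2) by (simp add: abs_mult mult_right_mono)
    show "integrable M (\<lambda>y. \<bar>k y * f y\<bar>)"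
      by (rule Bochner_Integration.integrable_bound[OF *])
         (use f k(1) le in \<open>auto intro: order_trans[OF le abs_ge_self]\<close>)
  qed
  finally show ?thesis by simp
qed

lemma bounded_of_compact_support:
  fixes f :: "'a::metric_space \<Rightarrow> real"
  assumes "continuous_on UNIV f" "compact K" "\<And>x. x \<notin> K \<Longrightarrow> f x = 0"
  obtains B where "0 \<le> B" "\<And>x. \<bar>f x\<bar> \<le> B"
proof -
  have "compact (f ` K)"
    using assms by (intro compact_continuous_image) (auto intro: continuous_on_subset)
  then obtain B where B: "\<And>x. x \<in> K \<Longrightarrow> \<bar>f x\<bar> \<le> B"
    using compact_imp_bounded[of "f ` K"] by (auto simp: bounded_iff)
  show ?thesis
  proof (rule that[of "max 0 B"])
    show "\<bar>f x\<bar> \<le> max 0 B" for x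
      using B[of x] assms(3)[of x] by (cases "x \<in> K") auto
  qed simp
qed

text \<open>The complement of the support is open and \<open>\<phi>\<close> is zero on it, so its
  derivative vanishes there too; continuity on a compact set supplies the bounds, merged into one
  constant \<open>B\<close>.\<close>

lemma test_function_obtain:
  assumes "\<phi> \<in> test_functions \<Omega>" and b: "b \<in> Basis"
  obtains K B where "compact K" "K \<subseteq> \<Omega>" "0 \<le> B"
    "\<And>x. \<bar>\<phi> x\<bar> \<le> B" "\<And>x. \<bar>frechet_derivative \<phi> (at x) b\<bar> \<le> B"
    "\<And>x. x \<notin> K \<Longrightarrow> \<phi> x = 0" "\<And>x. x \<notin> K \<Longrightarrow> frechet_derivative \<phi> (at x) b = 0"
    "\<phi> \<in> borel_measurable borel" "(\<lambda>x. frechet_derivative \<phi> (at x) b) \<in> borel_measurable borel"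
    "\<And>x. (\<phi> has_derivative frechet_derivative \<phi> (at x)) (at x)"
proof -
  define K where "K = closure {x. \<phi> x \<noteq> 0}"
  have K: "compact K" "K \<subseteq> \<Omega>" and C: "Ck k \<phi>" for k
    using assms(1) by (auto simp: test_functions_def K_def)
  have z: "\<phi> x = 0" if "x \<notin> K" for x
    using that closure_subset[of "{x. \<phi> x \<noteq> 0}"] by (auto simp: K_def)
  have dz: "frechet_derivative \<phi> (at x) b = 0" if "x \<notin> K" for x
  proof -
    have "((\<lambda>_. 0) has_derivative (\<lambda>_. 0)) (at x)" by simp
    then have "(\<phi> has_derivative (\<lambda>_. 0)) (at x)"
      by (rule has_derivative_transform_within_open[where s = "- K"])
         (use that z K(1) in \<open>auto simp: open_Compl compact_imp_closed\<close>)
    then show ?thesis by (metis frechet_derivative_at)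
  qed
  have c: "continuous_on UNIV \<phi>" using C[of 0] by simp
  have dc: "continuous_on UNIV (\<lambda>x. frechet_derivative \<phi> (at x) b)"
    using C[of "Suc 0"] b by simp
  obtain B1 where B1: "0 \<le> B1" "\<And>x. \<bar>\<phi> x\<bar> \<le> B1"
    using bounded_of_compact_support[OF c K(1) z] by blast
  obtain B2 where B2: "0 \<le> B2" "\<And>x. \<bar>frechet_derivative \<phi> (at x) b\<bar> \<le> B2"
    using bounded_of_compact_support[OF dc K(1) dz] by blast
  show ?thesis
  proof (rule that[of K "max B1 B2"])
    show "\<bar>\<phi> x\<bar> \<le> max B1 B2" "\<bar>frechet_derivative \<phi> (at x) b\<bar> \<le> max B1 B2" for x
      using B1(2)[of x] B2(2)[of x] by auto
    show "(\<phi> has_derivative frechet_derivative \<phi> (at x)) (at x)" for x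
      by (rule Ck_has_derivative[OF C])
  qed (use K z dz c dc B1(1) in \<open>auto intro: borel_measurable_continuous_onI\<close>)
qed

text \<open>The bridge from the integrals in the definitions to Borel functions over
  \<open>lborel\<close>. Completeness of Lebesgue measure makes the extension of \<open>h\<close> by
  zero measurable, as it agrees almost everywhere with \<open>g\<close>.\<close>

lemma integral_lebesgue_on_eq_lborel:
  fixes h g :: "'a::euclidean_space \<Rightarrow> real"
  assumes "S \<in> sets lebesgue" and g: "g \<in> borel_measurable borel"
    and ae: "AE x in lebesgue. indicator S x * h x = g x"
  shows "(LINT x|lebesgue_on S. h x) = (\<integral>x. g x \<partial>lborel)"
proof -
  have gl: "g \<in> borel_measurable lebesgue" using g by (auto intro: measurable_completion)
  have "(LINT x|lebesgue_on S. h x) = (LINT x|lebesgue. indicator S x * h x)"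
    using assms(1) by (simp add: integral_restrict_space)
  also have "\<dots> = (LINT x|lebesgue. g x)"
  proof (rule integral_cong_AE)
    show "(\<lambda>x. indicator S x * h x) \<in> borel_measurable lebesgue"
      by (rule borel_measurable_AE[OF gl]) (use ae in \<open>auto simp: eq_commute\<close>)
  qed (use gl ae in auto)
  also have "\<dots> = (\<integral>x. g x \<partial>lborel)"
    using g by (intro integral_completion) simp
  finally show ?thesis .
qed

lemma integrable_lebesgue_borel_representative:
  fixes f :: "'a::euclidean_space \<Rightarrow> real"
  assumes f: "integrable lebesgue f"
  obtains g where "integrable lborel g" "AE x in lebesgue. f x = g x"
proof -
  obtain g where g: "g \<in> borel_measurable lborel" "AE x in lborel. f x = g x"
    using completion_ex_borel_measurable_real[of f lborel] f by auto
  have ae: "AE x in lebesgue. f x = g x" by (rule AE_completion[OF g(2)])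
  have "integrable lebesgue g"
    by (rule integrable_cong_AE_imp[OF f]) (use measurable_completion[OF g(1)] ae in \<open>simp_all add: eq_commute\<close>)
  then have "integrable lborel g" using g(1) by (simp add: integrable_completion)
  then show ?thesis using ae that by blast
qed

text \<open>The bump centred at \<open>x\<close> serves as test function. After division by its
  integral, the left side is the derivative of \<open>mollify r f\<close> at \<open>x\<close> in
  direction \<open>b\<close>, and the right side is \<open>mollify r H x\<close>. Cutting off to
  \<open>K'\<close> is harmless because the kernel vanishes outside \<open>K'\<close>.\<close>

lemma mollify_weak_gradient:
  fixes u :: "'a::euclidean_space \<Rightarrow> real"
  assumes w: "has_weak_gradient \<Omega> u G" and b: "b \<in> Basis"
    and \<Omega>: "open \<Omega>" and K': "K' \<subseteq> \<Omega>"
    and f: "integrable lborel f" "AE x in lebesgue. indicator K' x * u x = f x"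
    and H: "integrable lborel H" "AE x in lebesgue. indicator K' x * (G x \<bullet> b) = H x"
    and r: "0 < r" "cball x r \<subseteq> K'"
  shows "- (\<integral>y. bump_deriv r (y - x) b * f y \<partial>lborel) = (\<integral>y. bump r (y - x) * H y \<partial>lborel)"
proof -
  have [measurable]: "f \<in> borel_measurable borel" "H \<in> borel_measurable borel" using f H by auto
  let ?\<phi> = "\<lambda>y. bump r (y - x)"
  have S: "\<Omega> \<in> sets lebesgue" using \<Omega> by simp
  have d: "frechet_derivative ?\<phi> (at y) = bump_deriv r (y - x)" for y
    using frechet_derivative_at[OF has_derivative_bump] by metis
  have out: "y \<notin> K' \<Longrightarrow> r \<le> norm (y - x)" for y
    using r(2) by (force simp: dist_norm norm_minus_commute)
  have out0: "bump r (y - x) = 0" "bump_deriv r (y - x) b = 0" if "y \<notin> K'" for y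
    using out[OF that] r(1) power_mono[of r "norm (y - x)" 2]
    by (auto simp: bump_eq_0 bump_deriv_def)
  have "?\<phi> \<in> test_functions \<Omega>"
    using r K' by (intro bump_test_function) auto
  then have "(LINT y|lebesgue_on \<Omega>. u y * bump_deriv r (y - x) b)
      = - (LINT y|lebesgue_on \<Omega>. (G y \<bullet> b) * bump r (y - x))"
    using w b unfolding has_weak_gradient_def by (auto simp: d)
  moreover have "(LINT y|lebesgue_on \<Omega>. u y * bump_deriv r (y - x) b)
      = (\<integral>y. bump_deriv r (y - x) b * f y \<partial>lborel)"
  proof (rule integral_lebesgue_on_eq_lborel[OF S])
    show "AE y in lebesgue. indicator \<Omega> y * (u y * bump_deriv r (y - x) b) = bump_deriv r (y - x) b * f y"
      using f(2)
    proof eventually_elim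
      case (elim y)
      then show ?case using K' out0[of y] by (cases "y \<in> K'") (auto simp: indicator_def)
    qed
  qed measurable
  moreover have "(LINT y|lebesgue_on \<Omega>. (G y \<bullet> b) * bump r (y - x))
      = (\<integral>y. bump r (y - x) * H y \<partial>lborel)"
  proof (rule integral_lebesgue_on_eq_lborel[OF S])
    show "AE y in lebesgue. indicator \<Omega> y * ((G y \<bullet> b) * bump r (y - x)) = bump r (y - x) * H y"
      using H(2)
    proof eventually_elim
      case (elim y)
      then show ?case using K' out0[of y] by (cases "y \<in> K'") (auto simp: indicator_def)
    qed
  qed measurable
  ultimately show ?thesis by simp
qed

lemma locally_integrable_representative:
  fixes u :: "'a::euclidean_space \<Rightarrow> real"
  assumes "locally_integrable \<Omega> u" "compact K" "K \<subseteq> \<Omega>"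
  obtains f where "integrable lborel f" "AE x in lebesgue. indicator K x * u x = f x"
proof -
  have "integrable lebesgue (\<lambda>x. indicator K x * u x)"
    using assms by (auto simp: locally_integrable_def set_integrable_def)
  then show ?thesis using integrable_lebesgue_borel_representative that by blast
qed

lemma locally_integrable_inner:
  assumes "locally_integrable \<Omega> G"
  shows "locally_integrable \<Omega> (\<lambda>x. G x \<bullet> b)"
  unfolding locally_integrable_def set_integrable_def
proof (intro allI impI)
  fix K :: "'a set" assume "compact K \<and> K \<subseteq> \<Omega>"
  then have "integrable lebesgue (\<lambda>x. indicator K x *\<^sub>R G x)"
    using assms by (auto simp: locally_integrable_def set_integrable_def)
  then have "integrable lebesgue (\<lambda>x. (indicator K x *\<^sub>R G x) \<bullet> b)"
    by (rule integrable_inner_left[rotated])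
  then show "integrable lebesgue (\<lambda>x. indicator K x *\<^sub>R (G x \<bullet> b))"
    by simp
qed

lemma integral_tendsto_of_L1_bound:
  fixes a :: "nat \<Rightarrow> 'a \<Rightarrow> real"
  assumes "\<And>n. integrable M (a n)" "integrable M c" "\<And>n. (\<integral>x. \<bar>a n x - c x\<bar> \<partial>M) \<le> w n" "w \<longlonglongrightarrow> 0"
  shows "(\<lambda>n. \<integral>x. a n x \<partial>M) \<longlonglongrightarrow> (\<integral>x. c x \<partial>M)"
proof -
  have "(\<lambda>n. (\<integral>x. a n x \<partial>M) - (\<integral>x. c x \<partial>M)) \<longlonglongrightarrow> 0"
  proof (rule Lim_null_comparison[OF always_eventually assms(4)], intro allI)
    fix n
    have "\<bar>\<integral>x. a n x - c x \<partial>M\<bar> \<le> (\<integral>x. \<bar>a n x - c x\<bar> \<partial>M)"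
      by (rule integral_abs_bound)
    then show "norm ((\<integral>x. a n x \<partial>M) - (\<integral>x. c x \<partial>M)) \<le> w n"
      using assms(3)[of n] by (simp add: assms(1,2))
  qed
  then show ?thesis by (simp add: LIM_zero_iff)
qed

text \<open>Kernels of radius at most \<open>\<epsilon>\<close> centred in \<open>K\<close> see only
  values on the compact set \<open>K'\<close>, where locally integrable functions are
  integrable.\<close>

lemma compact_neighbourhood:
  fixes \<Omega> :: "'a::euclidean_space set"
  assumes "compact K" "open \<Omega>" "K \<subseteq> \<Omega>"
  obtains \<epsilon> K' where "0 < \<epsilon>" "compact K'" "K' \<subseteq> \<Omega>" "K \<subseteq> K'" "\<And>x. x \<in> K \<Longrightarrow> cball x \<epsilon> \<subseteq> K'"
proof -
  obtain \<epsilon> where "\<epsilon> > 0" "(\<Union>x\<in>K. cball x \<epsilon>) \<subseteq> \<Omega>"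
    using compact_subset_open_imp_cball_epsilon_subset[OF assms] by blast
  then show ?thesis
    using compact_minkowski_sum_cball[OF assms(1)]
    by (intro that[of \<epsilon> "\<Union>x\<in>K. cball x \<epsilon>"]) (auto intro: less_imp_le)
qed

text \<open>The \<open>+ 1\<close> avoids division by zero at \<open>n = 0\<close> and makes the
  first term \<open>\<epsilon>\<close>. The sequence serves for mollification radii and, with
  \<open>\<epsilon> = 1\<close>, for the parameter of \<open>soft_pos\<close>.\<close>

definition shrinking :: "real \<Rightarrow> nat \<Rightarrow> real" where
  "shrinking \<epsilon> n = \<epsilon> / (real n + 1)"

lemma shrinking:
  assumes "0 < \<epsilon>"
  shows "0 < shrinking \<epsilon> n" "shrinking \<epsilon> n \<le> \<epsilon>" "shrinking \<epsilon> \<longlonglongrightarrow> 0"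
proof -
  show "0 < shrinking \<epsilon> n" "shrinking \<epsilon> n \<le> \<epsilon>"
    using assms by (auto simp: shrinking_def field_simps)
  show "shrinking \<epsilon> \<longlonglongrightarrow> 0"
    unfolding shrinking_def
    using tendsto_mult_right_zero[OF LIMSEQ_inverse_real_of_nat, of \<epsilon>]
    by (simp add: divide_inverse add.commute)
qed

text \<open>On \<open>K\<close> the mollifications of both candidates equal the derivative of the
  same mollification of \<open>u\<close>, so they coincide there. The L1 distance of the candidates
  on \<open>K\<close> is thus at most the sum of their two mollification errors, which tends to
  0.\<close>

lemma weak_gradient_unique_compact:
  fixes u :: "'a::euclidean_space \<Rightarrow> real"
  assumes w: "has_weak_gradient \<Omega> u G" "has_weak_gradient \<Omega> u G'" and b: "b \<in> Basis"
    and \<Omega>: "open \<Omega>" and K: "compact K" "K \<subseteq> \<Omega>"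
  shows "AE x in lebesgue. x \<in> K \<longrightarrow> G x \<bullet> b = G' x \<bullet> b"
proof -
  obtain \<epsilon> K' where \<epsilon>: "0 < \<epsilon>" and K': "compact K'" "K' \<subseteq> \<Omega>" "K \<subseteq> K'"
    and cb: "\<And>x. x \<in> K \<Longrightarrow> cball x \<epsilon> \<subseteq> K'"
    using compact_neighbourhood[OF K(1) \<Omega> K(2)] by metis
  have loc: "locally_integrable \<Omega> u" "locally_integrable \<Omega> G" "locally_integrable \<Omega> G'"
    using w by (auto simp: has_weak_gradient_def)
  obtain f where f: "integrable lborel f" "AE x in lebesgue. indicator K' x * u x = f x"
    by (rule locally_integrable_representative[OF loc(1) K'(1,2)])
  obtain H where H: "integrable lborel H" "AE x in lebesgue. indicator K' x * (G x \<bullet> b) = H x"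
    by (rule locally_integrable_representative[OF locally_integrable_inner[OF loc(2)] K'(1,2)])
  obtain H' where H': "integrable lborel H'" "AE x in lebesgue. indicator K' x * (G' x \<bullet> b) = H' x"
    by (rule locally_integrable_representative[OF locally_integrable_inner[OF loc(3)] K'(1,2)])
  define r where "r = shrinking \<epsilon>"
  have r: "0 < r n" "r n \<le> \<epsilon>" "r \<longlonglongrightarrow> 0" for n
    unfolding r_def using shrinking[OF \<epsilon>] by auto
  note mol = mollify_tendsto_L1[OF H(1), of r, OF r(1) r(3)] mollify_tendsto_L1[OF H'(1), of r, OF r(1) r(3)]
  have eq: "mollify (r n) H x = mollify (r n) H' x" if "x \<in> K" for n x
  proof -
    have c: "cball x (r n) \<subseteq> K'"
      using cb[OF that] subset_cball[OF r(2)] by blast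
    show ?thesis
      using mollify_weak_gradient[OF w(1) b \<Omega> K'(2) f H r(1) c]
        mollify_weak_gradient[OF w(2) b \<Omega> K'(2) f H' r(1) c]
      by (simp add: mollify_def)
  qed
  have [measurable]: "K \<in> sets borel" using K(1) by (simp add: borel_compact)
  have KH: "integrable lborel (\<lambda>x. indicator K x * \<bar>H x - H' x\<bar>)"
    by (rule Bochner_Integration.integrable_bound[of _ "\<lambda>x. \<bar>H x - H' x\<bar>"])
       (use H(1) H'(1) in \<open>auto simp: indicator_def\<close>)
  have i1: "integrable lborel (\<lambda>x. \<bar>mollify (r n) H x - H x\<bar>)" for n
    using mol(1)[of n] H(1) by auto
  have i2: "integrable lborel (\<lambda>x. \<bar>mollify (r n) H' x - H' x\<bar>)" for n
    using mol(3)[of n] H'(1) by auto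
  have le: "(\<integral>x. indicator K x * \<bar>H x - H' x\<bar> \<partial>lborel)
      \<le> (\<integral>x. \<bar>mollify (r n) H x - H x\<bar> \<partial>lborel) + (\<integral>x. \<bar>mollify (r n) H' x - H' x\<bar> \<partial>lborel)" for n
  proof -
    have "(\<integral>x. indicator K x * \<bar>H x - H' x\<bar> \<partial>lborel)
        \<le> (\<integral>x. \<bar>mollify (r n) H x - H x\<bar> + \<bar>mollify (r n) H' x - H' x\<bar> \<partial>lborel)"
    proof (rule integral_mono[OF KH])
      show "indicator K x * \<bar>H x - H' x\<bar> \<le> \<bar>mollify (r n) H x - H x\<bar> + \<bar>mollify (r n) H' x - H' x\<bar>" for x
        using eq[of x n] by (auto simp: indicator_def)
    qed (use i1[of n] i2[of n] in auto)
    then show ?thesis using i1[of n] i2[of n] by simp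
  qed
  have "(\<lambda>n. (\<integral>x. \<bar>mollify (r n) H x - H x\<bar> \<partial>lborel) + (\<integral>x. \<bar>mollify (r n) H' x - H' x\<bar> \<partial>lborel)) \<longlonglongrightarrow> 0"
    using mol(2,4) by (rule tendsto_add_zero)
  then have "(\<integral>x. indicator K x * \<bar>H x - H' x\<bar> \<partial>lborel) \<le> 0"
    by (rule LIMSEQ_le_const) (use le in auto)
  then have "(\<integral>x. indicator K x * \<bar>H x - H' x\<bar> \<partial>lborel) = 0"
    by (intro antisym integral_nonneg_AE) auto
  then have "AE x in lborel. indicator K x * \<bar>H x - H' x\<bar> = 0"
    using integral_nonneg_eq_0_iff_AE[OF KH] by auto
  from AE_completion[OF this] H(2) H'(2)
  show ?thesis
    by eventually_elim (use K'(3) in \<open>auto simp: indicator_def split: if_splits\<close>)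
qed

text \<open>An exhaustion of \<open>\<Omega>\<close> by countably many compact sets, together with a
  finite basis, leaves countably many exceptional null sets.\<close>

lemma weak_gradient_unique:
  fixes u :: "'a::euclidean_space \<Rightarrow> real"
  assumes w: "has_weak_gradient \<Omega> u G" "has_weak_gradient \<Omega> u G'" and \<Omega>: "open \<Omega>"
  shows "AE x in lebesgue_on \<Omega>. G x = G' x"
proof -
  obtain C where C: "\<And>n::nat. compact (C n)" "\<And>n. C n \<subseteq> \<Omega>" "\<Union>(range C) = \<Omega>"
    using open_Union_compact_subsets[OF \<Omega>] by metis
  have "AE x in lebesgue. \<forall>n. \<forall>b\<in>Basis. x \<in> C n \<longrightarrow> G x \<bullet> b = G' x \<bullet> b"
    unfolding AE_all_countable
    by (intro allI AE_finite_allI finite_Basis weak_gradient_unique_compact[OF w _ \<Omega> C(1,2)])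
  then have "AE x in lebesgue. x \<in> \<Omega> \<longrightarrow> G x = G' x"
    by eventually_elim (use C(3) in \<open>auto intro!: euclidean_eqI[where 'a = 'a]\<close>)
  then show ?thesis
    using \<Omega> by (simp add: AE_restrict_space_iff)
qed

subsection \<open>The chain rule for weak gradients\<close>

text \<open>For a mollification \<open>m n\<close>, the function \<open>F (m n x) * \<phi> x\<close>
  has compact support, so its derivative in direction \<open>b\<close> integrates to 0; this is the
  identity at stage \<open>n\<close>. In the limit, the left side converges because \<open>F\<close>
  is Lipschitz, the right side because \<open>F'\<close> is bounded and continuous.\<close>

lemma weak_chain_rule:
  fixes u :: "'a::euclidean_space \<Rightarrow> real"
  assumes w: "has_weak_gradient \<Omega> u G" and \<Omega>: "open \<Omega>"
    and F: "\<And>t. (F has_real_derivative F' t) (at t)" and F': "continuous_on UNIV F'"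
    and M: "\<And>t. \<bar>F' t\<bar> \<le> M"
    and \<phi>: "\<phi> \<in> test_functions \<Omega>" and b: "b \<in> Basis"
  shows "(LINT x|lebesgue_on \<Omega>. F (u x) * frechet_derivative \<phi> (at x) b)
    = - (LINT x|lebesgue_on \<Omega>. F' (u x) * (G x \<bullet> b) * \<phi> x)"
proof -
  define D where "D x = frechet_derivative \<phi> (at x) b" for x
  obtain K B where K: "compact K" "K \<subseteq> \<Omega>" and B: "0 \<le> B" "\<And>x. \<bar>\<phi> x\<bar> \<le> B" "\<And>x. \<bar>D x\<bar> \<le> B"
    and z: "\<And>x. x \<notin> K \<Longrightarrow> \<phi> x = 0" "\<And>x. x \<notin> K \<Longrightarrow> D x = 0"
    and [measurable]: "\<phi> \<in> borel_measurable borel" "D \<in> borel_measurable borel"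
    and \<phi>d: "\<And>x. (\<phi> has_derivative frechet_derivative \<phi> (at x)) (at x)"
    using test_function_obtain[OF \<phi> b] unfolding D_def[abs_def] by metis
  obtain \<epsilon> K' where \<epsilon>: "0 < \<epsilon>" and K': "compact K'" "K' \<subseteq> \<Omega>" "K \<subseteq> K'"
    and cb: "\<And>x. x \<in> K \<Longrightarrow> cball x \<epsilon> \<subseteq> K'"
    using compact_neighbourhood[OF K(1) \<Omega> K(2)] by metis
  have loc: "locally_integrable \<Omega> u" "locally_integrable \<Omega> G"
    using w by (auto simp: has_weak_gradient_def)
  obtain f where f: "integrable lborel f" "AE x in lebesgue. indicator K' x * u x = f x"
    by (rule locally_integrable_representative[OF loc(1) K'(1,2)])
  obtain H where H: "integrable lborel H" "AE x in lebesgue. indicator K' x * (G x \<bullet> b) = H x"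
    by (rule locally_integrable_representative[OF locally_integrable_inner[OF loc(2)] K'(1,2)])
  have [measurable]: "f \<in> borel_measurable borel" "H \<in> borel_measurable borel" using f H by auto
  have [measurable]: "K \<in> sets borel" using K(1) by (simp add: borel_compact)
  have [measurable]: "F' \<in> borel_measurable borel"
    by (rule borel_measurable_continuous_onI[OF F'])
  have [measurable]: "F \<in> borel_measurable borel"
    using DERIV_isCont[OF F] by (intro borel_measurable_continuous_onI continuous_at_imp_continuous_on) auto
  have M0: "0 \<le> M" using M[of 0] by simp
  have FL: "\<bar>F s - F t\<bar> \<le> M * \<bar>s - t\<bar>" for s t
    using field_differentiable_bound[where S = UNIV and f = F and f' = F' and B = M and x = s and y = t] F M
    by simp
  have FB: "\<bar>F t\<bar> \<le> \<bar>F 0\<bar> + M * \<bar>t\<bar>" for t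
    using FL[of t 0] by simp
  have K_int: "integrable lborel (\<lambda>x. \<bar>F 0\<bar> * B * indicator K x)"
    using emeasure_compact_finite[OF K(1)]
    by (intro integrable_mult_right integrable_real_indicator) auto
  \<comment> \<open>\<open>F\<close> grows at most linearly. Its constant part
    \<open>\<bar>F 0\<bar>\<close> is integrable here only because the factor \<open>k\<close> is
    supported in the compact set \<open>K\<close>.\<close>
  have iF: "integrable lborel (\<lambda>x. F (g x) * k x)"
    if g: "integrable lborel g" and [measurable]: "k \<in> borel_measurable borel"
      and k: "\<And>x. \<bar>k x\<bar> \<le> B" "\<And>x. x \<notin> K \<Longrightarrow> k x = 0" for g k
  proof (rule Bochner_Integration.integrable_bound)
    have [measurable]: "g \<in> borel_measurable borel" using g by auto
    show "integrable lborel (\<lambda>x. \<bar>F 0\<bar> * B * indicator K x + M * B * \<bar>g x\<bar>)"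
      using K_int g by auto
    show "AE x in lborel. norm (F (g x) * k x) \<le> norm (\<bar>F 0\<bar> * B * indicator K x + M * B * \<bar>g x\<bar>)"
    proof (rule AE_I2)
      fix x
      show "norm (F (g x) * k x) \<le> norm (\<bar>F 0\<bar> * B * indicator K x + M * B * \<bar>g x\<bar>)"
      proof (cases "x \<in> K")
        case True
        have "\<bar>F (g x) * k x\<bar> \<le> (\<bar>F 0\<bar> + M * \<bar>g x\<bar>) * B"
          unfolding abs_mult using FB[of "g x"] k(1)[of x] M0 by (intro mult_mono) auto
        then show ?thesis using True M0 B(1) by (simp add: algebra_simps)
      qed (use k(2) in simp)
    qed
    show "(\<lambda>x. F (g x) * k x) \<in> borel_measurable lborel" by measurable
  qed
  have iF': "integrable lborel (\<lambda>x. F' (g x) * h x * \<phi> x)"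
    if h: "integrable lborel h" and [measurable]: "g \<in> borel_measurable borel" for g h
  proof (rule Bochner_Integration.integrable_bound)
    have [measurable]: "h \<in> borel_measurable borel" using h by auto
    show "integrable lborel (\<lambda>x. M * B * \<bar>h x\<bar>)" using h by auto
    show "AE x in lborel. norm (F' (g x) * h x * \<phi> x) \<le> norm (M * B * \<bar>h x\<bar>)"
    proof (rule AE_I2)
      fix x
      have "\<bar>F' (g x)\<bar> * \<bar>\<phi> x\<bar> \<le> M * B"
        using M[of "g x"] B(2)[of x] M0 by (intro mult_mono) auto
      then have "\<bar>F' (g x)\<bar> * \<bar>\<phi> x\<bar> * \<bar>h x\<bar> \<le> M * B * \<bar>h x\<bar>"
        by (rule mult_right_mono) simp
      then show "norm (F' (g x) * h x * \<phi> x) \<le> norm (M * B * \<bar>h x\<bar>)"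
        using M0 B(1) by (simp add: abs_mult mult_ac)
    qed
    show "(\<lambda>x. F' (g x) * h x * \<phi> x) \<in> borel_measurable lborel" by measurable
  qed
  define r where "r = shrinking \<epsilon>"
  have r: "0 < r n" "r n \<le> \<epsilon>" "r \<longlonglongrightarrow> 0" for n
    unfolding r_def using shrinking[OF \<epsilon>] by auto
  define m where "m n = mollify (r n) f" for n
  define N where "N n = mollify (r n) H" for n
  have m: "integrable lborel (m n)" "(\<lambda>n. \<integral>x. \<bar>m n x - f x\<bar> \<partial>lborel) \<longlonglongrightarrow> 0" for n
    unfolding m_def using mollify_tendsto_L1[OF f(1), of r, OF r(1) r(3)] by auto
  have N: "integrable lborel (N n)" "(\<lambda>n. \<integral>x. \<bar>N n x - H x\<bar> \<partial>lborel) \<longlonglongrightarrow> 0" for n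
    unfolding N_def using mollify_tendsto_L1[OF H(1), of r, OF r(1) r(3)] by auto
  have [measurable]: "m n \<in> borel_measurable borel" "N n \<in> borel_measurable borel" for n
    using m(1)[of n] N(1)[of n] by auto
  have parts: "(\<integral>x. F (m n x) * D x \<partial>lborel) = - (\<integral>x. F' (m n x) * N n x * \<phi> x \<partial>lborel)" for n
  proof -
    define c where "c = (\<integral>z. bump (r n) z \<partial>(lborel :: 'a measure))"
    have c: "0 < c" unfolding c_def by (rule integral_bump_pos[OF r(1)])
    define d where "d x = - (\<integral>y. bump_deriv (r n) (y - x) b * f y \<partial>lborel) / c" for x
    have dm: "((\<lambda>t. m n (x + t *\<^sub>R b)) has_real_derivative d x) (at 0)" for x
      unfolding m_def d_def c_def by (rule mollify_line_derivative[OF f(1) r(1)])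
    have dN: "d x = N n x" if "x \<in> K" for x
    proof -
      have "cball x (r n) \<subseteq> K'"
        using cb[OF that] subset_cball[OF r(2)] by blast
      from mollify_weak_gradient[OF w b \<Omega> K'(2) f H r(1) this]
      show ?thesis by (simp add: d_def N_def mollify_def c_def)
    qed
    have d\<phi>: "((\<lambda>t. \<phi> (x + t *\<^sub>R b)) has_real_derivative D x) (at 0)" for x
    proof -
      have 1: "((\<lambda>t. x + t *\<^sub>R b) has_derivative (\<lambda>t. t *\<^sub>R b)) (at 0)"
        by (auto intro!: derivative_eq_intros)
      have 2: "(\<phi> has_derivative frechet_derivative \<phi> (at x)) (at (x + 0 *\<^sub>R b))"
        using \<phi>d[of x] by simp
      have "((\<lambda>t. \<phi> (x + t *\<^sub>R b)) has_derivative (\<lambda>t. frechet_derivative \<phi> (at x) (t *\<^sub>R b))) (at 0)"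
        by (rule has_derivative_compose[OF 1 2])
      then show ?thesis
        by (rule has_derivative_imp_has_field_derivative)
           (simp add: D_def linear_cmul[OF has_derivative_linear[OF \<phi>d]])
    qed
    \<comment> \<open>The true derivative of \<open>m n\<close> is \<open>d\<close>; writing
      \<open>N n\<close> instead is correct because the two agree on \<open>K\<close> and
      \<open>\<phi>\<close> vanishes off \<open>K\<close>.\<close>
    let ?\<psi>' = "\<lambda>x. F (m n x) * D x + F' (m n x) * N n x * \<phi> x"
    have d\<psi>: "((\<lambda>t. F (m n (x + t *\<^sub>R b)) * \<phi> (x + t *\<^sub>R b)) has_real_derivative ?\<psi>' x) (at 0)" for x
    proof -
      have "((\<lambda>t. F (m n (x + t *\<^sub>R b))) has_real_derivative F' (m n (x + 0 *\<^sub>R b)) * d x) (at 0)"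
        by (rule DERIV_chain2[OF F dm])
      from DERIV_mult[OF this d\<phi>]
      have "((\<lambda>t. F (m n (x + t *\<^sub>R b)) * \<phi> (x + t *\<^sub>R b)) has_real_derivative
          F (m n x) * D x + F' (m n x) * d x * \<phi> x) (at 0)"
        by (simp add: add.commute mult.commute)
      moreover have "d x * \<phi> x = N n x * \<phi> x"
        using dN[of x] z(1)[of x] by (cases "x \<in> K") auto
      ultimately show ?thesis by (simp add: mult.assoc)
    qed
    define C where "C = (\<integral>x. \<bar>f x\<bar> \<partial>lborel)"
    \<comment> \<open>These bounds may depend on \<open>n\<close>: the integral of the derivative is
      shown to vanish for each fixed \<open>n\<close> before any limit is taken.\<close>
    have mb: "\<bar>m n x\<bar> \<le> C / c" for x
    proof -
      have "\<bar>\<integral>y. bump (r n) (y - x) * f y \<partial>lborel\<bar> \<le> 1 * C"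
        unfolding C_def by (rule abs_integral_mult_le[OF f(1)]) (auto simp: abs_bump_le_1)
      then show ?thesis
        using c by (simp add: m_def mollify_def c_def[symmetric] abs_divide divide_right_mono)
    qed
    have db: "\<bar>d x\<bar> \<le> 4 * r n * norm b * C / c" for x
    proof -
      have "\<bar>\<integral>y. bump_deriv (r n) (y - x) b * f y \<partial>lborel\<bar> \<le> 4 * r n * norm b * C"
        unfolding C_def using r(1)[of n]
        by (intro abs_integral_mult_le[OF f(1)]) (auto intro!: abs_bump_deriv_le)
      then show ?thesis
        using c by (simp add: d_def abs_divide divide_right_mono)
    qed
    have "\<bar>?\<psi>' x\<bar> \<le> (\<bar>F 0\<bar> + M * (C / c)) * B + M * (4 * r n * norm b * C / c) * B" for x
    proof (cases "x \<in> K")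
      case True
      have "\<bar>F (m n x)\<bar> \<le> \<bar>F 0\<bar> + M * (C / c)"
        using FB[of "m n x"] mult_left_mono[OF mb[of x] M0] by linarith
      then have "\<bar>F (m n x) * D x\<bar> \<le> (\<bar>F 0\<bar> + M * (C / c)) * B"
        unfolding abs_mult using B(3)[of x] by (intro mult_mono) auto
      moreover have "\<bar>F' (m n x) * N n x * \<phi> x\<bar> \<le> M * (4 * r n * norm b * C / c) * B"
      proof -
        have N: "\<bar>N n x\<bar> \<le> 4 * r n * norm b * C / c" using db[of x] dN[OF True] by simp
        have E: "0 \<le> 4 * r n * norm b * C / c" using abs_ge_zero N by (rule order_trans)
        show ?thesis
          unfolding abs_mult by (intro mult_mono mult_nonneg_nonneg M B(2) N M0 E abs_ge_zero)
      qed
      ultimately show ?thesis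
        using abs_triangle_ineq[of "F (m n x) * D x" "F' (m n x) * N n x * \<phi> x"] by linarith
    next
      case False
      have "0 \<le> C / c" "0 \<le> 4 * r n * norm b * C / c"
        using mb[of x] db[of x] abs_ge_zero[of "m n x"] abs_ge_zero[of "d x"] by linarith+
      then have "0 \<le> (\<bar>F 0\<bar> + M * (C / c)) * B + M * (4 * r n * norm b * C / c) * B"
        using M0 B(1) by (intro add_nonneg_nonneg mult_nonneg_nonneg) auto
      then show ?thesis using False z by simp
    qed
    then have "(\<integral>x. ?\<psi>' x \<partial>lborel) = 0"
      by (rule integral_line_derivative_eq_0[OF d\<psi>])
         (use iF[OF m(1), of \<phi> n] B(2) z(1) K(1) in auto)
    moreover have "(\<integral>x. ?\<psi>' x \<partial>lborel)
        = (\<integral>x. F (m n x) * D x \<partial>lborel) + (\<integral>x. F' (m n x) * N n x * \<phi> x \<partial>lborel)"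
      by (rule Bochner_Integration.integral_add) (use iF[OF m(1), of D n] iF'[OF N(1)] B(3) z(2) in auto)
    ultimately show ?thesis by simp
  qed
  have mi: "integrable lborel (\<lambda>x. m n x - f x)" for n using m(1)[of n] f(1) by auto
  \<comment> \<open>Convergence in L1 gives pointwise convergence only along a subsequence; the
    continuity of \<open>F'\<close> acts on pointwise limits.\<close>
  obtain s where s: "strict_mono s" "AE x in lborel. (\<lambda>n. m (s n) x - f x) \<longlonglongrightarrow> 0"
  proof -
    have "(\<lambda>n. \<integral>x. norm (m n x - f x) \<partial>lborel) \<longlonglongrightarrow> 0" using m(2) by simp
    from tendsto_L1_AE_subseq[where u = "\<lambda>n x. m n x - f x", OF mi this]
    show ?thesis using that by blast
  qed
  have lim1: "(\<lambda>n. \<integral>x. F (m (s n) x) * D x \<partial>lborel) \<longlonglongrightarrow> (\<integral>x. F (f x) * D x \<partial>lborel)"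
  proof (rule integral_tendsto_of_L1_bound[where w = "\<lambda>n. M * B * (\<integral>x. \<bar>m (s n) x - f x\<bar> \<partial>lborel)"])
    show i: "integrable lborel (\<lambda>x. F (m (s n) x) * D x)" for n
      by (rule iF[OF m(1)]) (use B z in auto)
    show i': "integrable lborel (\<lambda>x. F (f x) * D x)"
      by (rule iF[OF f(1)]) (use B z in auto)
    show "(\<integral>x. \<bar>F (m (s n) x) * D x - F (f x) * D x\<bar> \<partial>lborel) \<le> M * B * (\<integral>x. \<bar>m (s n) x - f x\<bar> \<partial>lborel)" for n
    proof -
      have "(\<integral>x. \<bar>F (m (s n) x) * D x - F (f x) * D x\<bar> \<partial>lborel) \<le> (\<integral>x. M * B * \<bar>m (s n) x - f x\<bar> \<partial>lborel)"
      proof (rule integral_mono)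
        show "\<bar>F (m (s n) x) * D x - F (f x) * D x\<bar> \<le> M * B * \<bar>m (s n) x - f x\<bar>" for x
        proof -
          have "\<bar>F (m (s n) x) - F (f x)\<bar> * \<bar>D x\<bar> \<le> (M * \<bar>m (s n) x - f x\<bar>) * B"
            using FL B(3)[of x] M0 by (intro mult_mono) auto
          then show ?thesis
            unfolding left_diff_distrib[symmetric] abs_mult by (simp add: mult_ac)
        qed
      qed (use i[of n] i' mi[of "s n"] in auto)
      then show ?thesis by simp
    qed
    show "(\<lambda>n. M * B * (\<integral>x. \<bar>m (s n) x - f x\<bar> \<partial>lborel)) \<longlonglongrightarrow> 0"
      using LIMSEQ_subseq_LIMSEQ[OF m(2) s(1)] by (intro tendsto_mult_right_zero) (simp add: comp_def)
  qed
  have lim2: "(\<lambda>n. \<integral>x. F' (m (s n) x) * N (s n) x * \<phi> x \<partial>lborel) \<longlonglongrightarrow> (\<integral>x. F' (f x) * H x * \<phi> x \<partial>lborel)"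
  proof (rule integral_tendsto_of_L1_bound)
    \<comment> \<open>The error is split in two: \<open>?w1\<close> replaces \<open>N\<close> by
      \<open>H\<close> under the bounded factor \<open>F'\<close>, and \<open>?w2\<close> replaces
      \<open>F' (m (s n) x)\<close> by \<open>F' (f x)\<close> with \<open>H\<close> fixed, where
      \<open>2 * M * B * \<bar>H x\<bar>\<close> dominates.\<close>
    let ?w1 = "\<lambda>n. M * B * (\<integral>x. \<bar>N (s n) x - H x\<bar> \<partial>lborel)"
    let ?w2 = "\<lambda>n. \<integral>x. \<bar>F' (m (s n) x) - F' (f x)\<bar> * \<bar>H x * \<phi> x\<bar> \<partial>lborel"
    show i: "integrable lborel (\<lambda>x. F' (m (s n) x) * N (s n) x * \<phi> x)" for n
      by (rule iF'[OF N(1)]) measurable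
    show i': "integrable lborel (\<lambda>x. F' (f x) * H x * \<phi> x)"
      by (rule iF'[OF H(1)]) measurable
    have i2: "integrable lborel (\<lambda>x. \<bar>F' (m (s n) x) - F' (f x)\<bar> * \<bar>H x * \<phi> x\<bar>)" for n
    proof -
      have "integrable lborel (\<lambda>x. F' (m (s n) x) * H x * \<phi> x - F' (f x) * H x * \<phi> x)"
        by (intro Bochner_Integration.integrable_diff i' iF'[OF H(1)]) measurable
      then have "integrable lborel (\<lambda>x. \<bar>F' (m (s n) x) * H x * \<phi> x - F' (f x) * H x * \<phi> x\<bar>)"
        by (rule integrable_abs)
      moreover have "\<bar>F' (m (s n) x) * H x * \<phi> x - F' (f x) * H x * \<phi> x\<bar>
          = \<bar>F' (m (s n) x) - F' (f x)\<bar> * \<bar>H x * \<phi> x\<bar>" for x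
        by (simp add: abs_mult[symmetric] algebra_simps)
      ultimately show ?thesis by simp
    qed
    have i3: "integrable lborel (\<lambda>x. M * B * \<bar>N (s n) x - H x\<bar>)" for n
      using N(1)[of "s n"] H(1) by auto
    show "(\<integral>x. \<bar>F' (m (s n) x) * N (s n) x * \<phi> x - F' (f x) * H x * \<phi> x\<bar> \<partial>lborel) \<le> ?w1 n + ?w2 n" for n
    proof -
      have "(\<integral>x. \<bar>F' (m (s n) x) * N (s n) x * \<phi> x - F' (f x) * H x * \<phi> x\<bar> \<partial>lborel)
        \<le> (\<integral>x. M * B * \<bar>N (s n) x - H x\<bar> + \<bar>F' (m (s n) x) - F' (f x)\<bar> * \<bar>H x * \<phi> x\<bar> \<partial>lborel)"
      proof (rule integral_mono)
        fix x
        have "F' (m (s n) x) * N (s n) x * \<phi> x - F' (f x) * H x * \<phi> x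
            = F' (m (s n) x) * \<phi> x * (N (s n) x - H x) + (F' (m (s n) x) - F' (f x)) * (H x * \<phi> x)"
          by (simp add: algebra_simps)
        also have "\<bar>\<dots>\<bar> \<le> \<bar>F' (m (s n) x)\<bar> * \<bar>\<phi> x\<bar> * \<bar>N (s n) x - H x\<bar>
            + \<bar>F' (m (s n) x) - F' (f x)\<bar> * \<bar>H x * \<phi> x\<bar>"
          unfolding abs_mult[symmetric] by (rule abs_triangle_ineq)
        also have "\<bar>F' (m (s n) x)\<bar> * \<bar>\<phi> x\<bar> * \<bar>N (s n) x - H x\<bar> \<le> M * B * \<bar>N (s n) x - H x\<bar>"
          using M B(2)[of x] M0 by (intro mult_right_mono mult_mono) auto
        finally show "\<bar>F' (m (s n) x) * N (s n) x * \<phi> x - F' (f x) * H x * \<phi> x\<bar>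
            \<le> M * B * \<bar>N (s n) x - H x\<bar> + \<bar>F' (m (s n) x) - F' (f x)\<bar> * \<bar>H x * \<phi> x\<bar>"
          by simp
      next
        show "integrable lborel (\<lambda>x. \<bar>F' (m (s n) x) * N (s n) x * \<phi> x - F' (f x) * H x * \<phi> x\<bar>)"
          by (intro integrable_abs Bochner_Integration.integrable_diff i i')
        show "integrable lborel (\<lambda>x. M * B * \<bar>N (s n) x - H x\<bar> + \<bar>F' (m (s n) x) - F' (f x)\<bar> * \<bar>H x * \<phi> x\<bar>)"
          by (intro Bochner_Integration.integrable_add i2 i3)
      qed
      also have "\<dots> = ?w1 n + ?w2 n"
        by (subst Bochner_Integration.integral_add[OF i3 i2]) simp
      finally show ?thesis .
    qed
    have "?w2 \<longlonglongrightarrow> (\<integral>x. 0 \<partial>(lborel :: 'a measure))"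
    proof (rule integral_dominated_convergence[where w = "\<lambda>x. 2 * M * B * \<bar>H x\<bar>"])
      show "AE x in lborel. (\<lambda>n. \<bar>F' (m (s n) x) - F' (f x)\<bar> * \<bar>H x * \<phi> x\<bar>) \<longlonglongrightarrow> 0"
        using s(2)
      proof eventually_elim
        case (elim x)
        then have "(\<lambda>n. m (s n) x) \<longlonglongrightarrow> f x" by (simp add: LIM_zero_iff)
        moreover have "isCont F' (f x)" using F' by (simp add: continuous_on_eq_continuous_at)
        ultimately have "(\<lambda>n. F' (m (s n) x)) \<longlonglongrightarrow> F' (f x)"
          by (rule isCont_tendsto_compose[rotated])
        then have "(\<lambda>n. \<bar>F' (m (s n) x) - F' (f x)\<bar>) \<longlonglongrightarrow> 0"
          by (simp add: LIM_zero_iff tendsto_rabs_zero_iff)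
        then show ?case by (rule tendsto_mult_left_zero)
      qed
      show "AE x in lborel. norm (\<bar>F' (m (s n) x) - F' (f x)\<bar> * \<bar>H x * \<phi> x\<bar>) \<le> 2 * M * B * \<bar>H x\<bar>" for n
      proof (rule AE_I2)
        fix x
        have "\<bar>F' (m (s n) x) - F' (f x)\<bar> \<le> 2 * M"
          using M[of "m (s n) x"] M[of "f x"] by linarith
        then have "\<bar>F' (m (s n) x) - F' (f x)\<bar> * (\<bar>H x\<bar> * \<bar>\<phi> x\<bar>) \<le> 2 * M * (\<bar>H x\<bar> * B)"
          using B(2)[of x] M0 by (intro mult_mono) auto
        then show "norm (\<bar>F' (m (s n) x) - F' (f x)\<bar> * \<bar>H x * \<phi> x\<bar>) \<le> 2 * M * B * \<bar>H x\<bar>"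
          by (simp add: abs_mult mult_ac)
      qed
      show "integrable lborel (\<lambda>x. 2 * M * B * \<bar>H x\<bar>)" using H(1) by auto
    qed measurable
    moreover have "?w1 \<longlonglongrightarrow> 0"
      using LIMSEQ_subseq_LIMSEQ[OF N(2) s(1)] by (intro tendsto_mult_right_zero) (simp add: comp_def)
    ultimately show "(\<lambda>n. ?w1 n + ?w2 n) \<longlonglongrightarrow> 0"
      by (intro tendsto_add_zero) simp_all
  qed
  have lborel_eq: "(\<integral>x. F (f x) * D x \<partial>lborel) = - (\<integral>x. F' (f x) * H x * \<phi> x \<partial>lborel)"
    using LIMSEQ_unique[OF lim1] tendsto_minus[OF lim2] by (simp add: parts)
  have S: "\<Omega> \<in> sets lebesgue" using \<Omega> by simp
  have "(LINT x|lebesgue_on \<Omega>. F (u x) * D x) = (\<integral>x. F (f x) * D x \<partial>lborel)"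
  proof (rule integral_lebesgue_on_eq_lborel[OF S])
    show "AE x in lebesgue. indicator \<Omega> x * (F (u x) * D x) = F (f x) * D x"
      using f(2)
    proof eventually_elim
      case (elim x)
      then show ?case using z(2)[of x] K' K(2) by (cases "x \<in> K") (auto simp: indicator_def)
    qed
  qed measurable
  moreover have "(LINT x|lebesgue_on \<Omega>. F' (u x) * (G x \<bullet> b) * \<phi> x) = (\<integral>x. F' (f x) * H x * \<phi> x \<partial>lborel)"
  proof (rule integral_lebesgue_on_eq_lborel[OF S])
    show "AE x in lebesgue. indicator \<Omega> x * (F' (u x) * (G x \<bullet> b) * \<phi> x) = F' (f x) * H x * \<phi> x"
      using f(2) H(2)
    proof eventually_elim
      case (elim x)
      then show ?case using z(1)[of x] K' K(2) by (cases "x \<in> K") (auto simp: indicator_def)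
    qed
  qed measurable
  ultimately show ?thesis
    using lborel_eq by (simp add: D_def)
qed

subsection \<open>Truncation to the unit interval\<close>

text \<open>
  This choice of \<open>C\<^sup>1\<close> approximations of the positive part has derivatives that converge to the
  indicator of \<open>{0<..}\<close> at every point, \<open>0\<close> included; hence \<open>\<nabla>u = 0\<close> on the level sets of
  \<open>u\<close> need not be known.
\<close>
definition soft_pos :: "real \<Rightarrow> real \<Rightarrow> real" where
  "soft_pos \<delta> t = (max 0 t)\<^sup>2 / (max 0 t + \<delta>)"

text \<open>For \<open>t > 0\<close> it comes from t^2 / (t + \<delta>) = t - \<delta> + \<delta>^2
  / (t + \<delta>). This form shows at once that the values lie between 0 and 1.\<close>

definition soft_pos_deriv :: "real \<Rightarrow> real \<Rightarrow> real" where
  "soft_pos_deriv \<delta> t = 1 - (\<delta> / (max 0 t + \<delta>))\<^sup>2"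

lemma has_real_derivative_soft_pos:
  assumes \<delta>: "0 < \<delta>"
  shows "(soft_pos \<delta> has_real_derivative soft_pos_deriv \<delta> t) (at t)"
proof (cases t "0 :: real" rule: linorder_cases)
  case less
  have "((\<lambda>_. 0) has_real_derivative 0) (at t)" by simp
  moreover have "\<forall>\<^sub>F s in nhds t. 0 = soft_pos \<delta> s"
    using eventually_nhds_in_open[of "{..<0}" t] less
    by (auto elim!: eventually_mono simp: soft_pos_def)
  ultimately have "(soft_pos \<delta> has_real_derivative 0) (at t)"
    using DERIV_cong_ev[of t t "\<lambda>_. 0" "soft_pos \<delta>" 0 0] by simp
  then show ?thesis using less \<delta> by (simp add: soft_pos_deriv_def)
next
  case equal
  have "((\<lambda>h. soft_pos \<delta> h / h) \<longlongrightarrow> 0) (at 0)"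
  proof (rule Lim_null_comparison)
    \<comment> \<open>To the right of 0 the function is at most \<open>h\<^sup>2 / \<delta>\<close>,
      and to the left it is zero, so its derivative at 0 vanishes.\<close>
    show "\<forall>\<^sub>F h in at 0. norm (soft_pos \<delta> h / h) \<le> \<bar>h\<bar> / \<delta>"
    proof (rule always_eventually, rule allI)
      fix h :: real
      show "norm (soft_pos \<delta> h / h) \<le> \<bar>h\<bar> / \<delta>"
      proof (cases "0 < h")
        case True
        then have "soft_pos \<delta> h / h = h / (h + \<delta>)"
          by (simp add: soft_pos_def power2_eq_square)
        moreover have "h / (h + \<delta>) \<le> h / \<delta>"
          using True \<delta> by (intro divide_left_mono) auto
        ultimately show ?thesis using True \<delta> by simp
      next
        case False
        then have "soft_pos \<delta> h = 0" by (simp add: soft_pos_def)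
        then show ?thesis using \<delta> by simp
      qed
    qed
    have "((\<lambda>h. \<bar>h\<bar> / \<delta>) \<longlongrightarrow> \<bar>0\<bar> / \<delta>) (at 0)"
      by (intro tendsto_intros) (use \<delta> in auto)
    then show "((\<lambda>h. \<bar>h\<bar> / \<delta>) \<longlongrightarrow> 0) (at 0)" by simp
  qed
  then show ?thesis
    using equal \<delta> by (simp add: DERIV_def soft_pos_deriv_def) (simp add: soft_pos_def)
next
  case greater
  have "((\<lambda>s. s\<^sup>2 / (s + \<delta>)) has_real_derivative soft_pos_deriv \<delta> t) (at t)"
    using greater \<delta>
    by (auto intro!: derivative_eq_intros simp: soft_pos_deriv_def divide_simps power2_eq_square)
       (simp add: algebra_simps)
  moreover have "\<forall>\<^sub>F s in nhds t. s\<^sup>2 / (s + \<delta>) = soft_pos \<delta> s"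
    using eventually_nhds_in_open[of "{0<..}" t] greater
    by (auto elim!: eventually_mono simp: soft_pos_def)
  ultimately show ?thesis
    using DERIV_cong_ev[of t t "\<lambda>s. s\<^sup>2 / (s + \<delta>)" "soft_pos \<delta>"] by blast
qed

lemma continuous_on_soft_pos_deriv:
  assumes "0 < \<delta>"
  shows "continuous_on S (soft_pos_deriv \<delta>)"
  unfolding soft_pos_deriv_def
  by (intro continuous_intros) (use assms in \<open>auto simp: add_nonneg_eq_0_iff\<close>)

lemma soft_pos_deriv_bounds:
  assumes "0 < \<delta>"
  shows "0 \<le> soft_pos_deriv \<delta> t" "soft_pos_deriv \<delta> t \<le> 1"
proof -
  have "0 \<le> \<delta> / (max 0 t + \<delta>)" "\<delta> / (max 0 t + \<delta>) \<le> 1"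
    using assms by (auto simp: divide_le_eq)
  then have "(\<delta> / (max 0 t + \<delta>))\<^sup>2 \<le> 1"
    by (simp add: power_le_one)
  then show "0 \<le> soft_pos_deriv \<delta> t" "soft_pos_deriv \<delta> t \<le> 1"
    by (auto simp: soft_pos_deriv_def)
qed

lemma tendsto_soft_pos:
  assumes "d \<longlonglongrightarrow> 0" "\<And>n::nat. 0 < d n"
  shows "(\<lambda>n. soft_pos (d n) t) \<longlonglongrightarrow> max 0 t"
    and "(\<lambda>n. soft_pos_deriv (d n) t) \<longlonglongrightarrow> (if 0 < t then 1 else 0)"
proof -
  consider "t \<le> 0" | "0 < t" by linarith
  then show "(\<lambda>n. soft_pos (d n) t) \<longlonglongrightarrow> max 0 t"
  proof cases
    case 2
    have "(\<lambda>n. t\<^sup>2 / (t + d n)) \<longlonglongrightarrow> t\<^sup>2 / (t + 0)"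
      by (intro tendsto_intros assms) (use 2 in auto)
    then show ?thesis using 2 by (simp add: soft_pos_def power2_eq_square)
  qed (simp add: soft_pos_def)
  consider "t \<le> 0" | "0 < t" by linarith
  then show "(\<lambda>n. soft_pos_deriv (d n) t) \<longlonglongrightarrow> (if 0 < t then 1 else 0)"
  proof cases
    case 1
    \<comment> \<open>For \<open>t \<le> 0\<close> the derivative is
      \<open>1 - (d n / d n)\<^sup>2\<close>, which is exactly 0 once \<open>d n\<close> is nonzero;
      this settles the value at \<open>t = 0\<close>.\<close>
    have "d n \<noteq> 0" for n using assms(2)[of n] by simp
    then show ?thesis using 1 by (simp add: soft_pos_deriv_def)
  next
    case 2
    have "(\<lambda>n. 1 - (d n / (t + d n))\<^sup>2) \<longlonglongrightarrow> 1 - (0 / (t + 0))\<^sup>2"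
      by (intro tendsto_intros assms) (use 2 in auto)
    then show ?thesis using 2 by (simp add: soft_pos_deriv_def)
  qed
qed

definition clamp01 :: "real \<Rightarrow> real" where
  "clamp01 t = max 0 (min 1 t)"

text \<open>
  The value \<open>1\<close> at \<open>t = 1\<close> comes from \<open>clamp01 t = max 0 t - max 0 (t - 1)\<close>.
\<close>
definition clamp01_deriv :: "real \<Rightarrow> real" where
  "clamp01_deriv t = (if 0 < t \<and> t \<le> 1 then 1 else 0)"

lemma borel_measurable_clamp01 [measurable]: "clamp01 \<in> borel_measurable borel"
  unfolding clamp01_def by measurable

lemma borel_measurable_clamp01_deriv [measurable]: "clamp01_deriv \<in> borel_measurable borel"
  unfolding clamp01_deriv_def by measurable

lemma abs_clamp01_le: "\<bar>clamp01 t\<bar> \<le> \<bar>t\<bar>"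
  by (auto simp: clamp01_def)

lemma locally_integrable_clamp01:
  assumes "locally_integrable \<Omega> u"
  shows "locally_integrable \<Omega> (\<lambda>x. clamp01 (u x))"
  unfolding locally_integrable_def set_integrable_def
proof (intro allI impI)
  fix K :: "'a set" assume "compact K \<and> K \<subseteq> \<Omega>"
  then have i: "integrable lebesgue (\<lambda>x. indicator K x *\<^sub>R u x)"
    using assms by (auto simp: locally_integrable_def set_integrable_def)
  \<comment> \<open>Measurability is known for the cut-off function; as
    \<open>clamp01 0 = 0\<close>, clamping commutes with the cut-off.\<close>
  have "integrable lebesgue (\<lambda>x. clamp01 (indicator K x *\<^sub>R u x))"
    by (rule Bochner_Integration.integrable_bound[OF i])
       (use i abs_clamp01_le in \<open>auto intro: borel_measurable_integrable measurable_compose[OF _ borel_measurable_clamp01]\<close>)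
  moreover have "clamp01 (indicator K x *\<^sub>R u x) = indicator K x *\<^sub>R clamp01 (u x)" for x
    by (auto simp: indicator_def clamp01_def)
  ultimately show "integrable lebesgue (\<lambda>x. indicator K x *\<^sub>R clamp01 (u x))" by simp
qed

lemma locally_integrable_clamp01_deriv:
  fixes G :: "'a::euclidean_space \<Rightarrow> 'a"
  assumes "locally_integrable \<Omega> u" "locally_integrable \<Omega> G"
  shows "locally_integrable \<Omega> (\<lambda>x. clamp01_deriv (u x) *\<^sub>R G x)"
  unfolding locally_integrable_def set_integrable_def
proof (intro allI impI)
  fix K :: "'a set" assume "compact K \<and> K \<subseteq> \<Omega>"
  then have i: "integrable lebesgue (\<lambda>x. indicator K x *\<^sub>R u x)" "integrable lebesgue (\<lambda>x. indicator K x *\<^sub>R G x)"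
    using assms by (auto simp: locally_integrable_def set_integrable_def)
  \<comment> \<open>The cut-off is placed inside \<open>clamp01_deriv\<close> so that its argument
    is measurable on the whole space.\<close>
  have "integrable lebesgue (\<lambda>x. clamp01_deriv (indicator K x *\<^sub>R u x) *\<^sub>R (indicator K x *\<^sub>R G x))"
  proof (rule Bochner_Integration.integrable_bound[OF i(2)])
    show "(\<lambda>x. clamp01_deriv (indicator K x *\<^sub>R u x) *\<^sub>R (indicator K x *\<^sub>R G x)) \<in> borel_measurable lebesgue"
      using i by (intro borel_measurable_scaleR measurable_compose[OF _ borel_measurable_clamp01_deriv]
          borel_measurable_integrable)
  qed (auto simp: clamp01_deriv_def)
  also have "(\<lambda>x. clamp01_deriv (indicator K x *\<^sub>R u x) *\<^sub>R (indicator K x *\<^sub>R G x))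
      = (\<lambda>x. indicator K x *\<^sub>R (clamp01_deriv (u x) *\<^sub>R G x))"
    by (auto simp: indicator_def)
  finally show "integrable lebesgue (\<lambda>x. indicator K x *\<^sub>R (clamp01_deriv (u x) *\<^sub>R G x))" .
qed

text \<open>The C1 chain rule is applied to smoothings of \<open>max 0 t - max 0 (t - 1)\<close>,
  with the bounds \<open>\<bar>t\<bar>\<close> on the functions and 1 on the derivatives; dominated
  convergence removes the smoothing.\<close>

lemma has_weak_gradient_clamp01:
  fixes u :: "'a::euclidean_space \<Rightarrow> real"
  assumes w: "has_weak_gradient \<Omega> u G" and \<Omega>: "open \<Omega>"
  shows "has_weak_gradient \<Omega> (\<lambda>x. clamp01 (u x)) (\<lambda>x. clamp01_deriv (u x) *\<^sub>R G x)"
  unfolding has_weak_gradient_def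
proof (intro conjI ballI)
  have loc: "locally_integrable \<Omega> u" "locally_integrable \<Omega> G"
    using w by (auto simp: has_weak_gradient_def)
  show "locally_integrable \<Omega> (\<lambda>x. clamp01 (u x))"
    "locally_integrable \<Omega> (\<lambda>x. clamp01_deriv (u x) *\<^sub>R G x)"
    using loc by (auto intro: locally_integrable_clamp01 locally_integrable_clamp01_deriv)
  fix \<phi> and b :: 'a
  assume \<phi>: "\<phi> \<in> test_functions \<Omega>" and b: "b \<in> Basis"
  define D where "D x = frechet_derivative \<phi> (at x) b" for x
  obtain K B where K: "compact K" "K \<subseteq> \<Omega>" and B: "0 \<le> B" "\<And>x. \<bar>\<phi> x\<bar> \<le> B" "\<And>x. \<bar>D x\<bar> \<le> B"
    and z: "\<And>x. x \<notin> K \<Longrightarrow> \<phi> x = 0" "\<And>x. x \<notin> K \<Longrightarrow> D x = 0"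
    and bm: "\<phi> \<in> borel_measurable borel" "D \<in> borel_measurable borel"
    using test_function_obtain[OF \<phi> b] unfolding D_def[abs_def] by metis
  let ?L = "lebesgue_on \<Omega>"
  have [measurable]: "\<phi> \<in> borel_measurable ?L" "D \<in> borel_measurable ?L"
    using bm by (auto intro!: measurable_restrict_space1 measurable_completion)
  \<comment> \<open>The majorants have to be integrable on all of \<open>\<Omega>\<close>, where
    \<open>u\<close> and \<open>G\<close> are only locally integrable; off \<open>K\<close> the test
    function and its derivative vanish.\<close>
  define v where "v x = indicator K x * u x" for x
  define h where "h x = indicator K x * (G x \<bullet> b)" for x
  have int: "integrable ?L (\<lambda>x. indicator K x * k x)" if "locally_integrable \<Omega> k" for k :: "'a \<Rightarrow> real"
  proof -
    have "integrable lebesgue (\<lambda>x. indicator K x * k x)"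
      using that K by (auto simp: locally_integrable_def set_integrable_def)
    also have "(\<lambda>x. indicator K x * k x) = (\<lambda>x. indicator \<Omega> x *\<^sub>R (indicator K x * k x))"
      using K(2) by (auto simp: indicator_def fun_eq_iff)
    finally show ?thesis
      using \<Omega> by (subst integrable_restrict_space) auto
  qed
  have v: "integrable ?L v" unfolding v_def by (rule int[OF loc(1)])
  have h: "integrable ?L h" unfolding h_def by (rule int[OF locally_integrable_inner[OF loc(2)]])
  have [measurable]: "v \<in> borel_measurable ?L" "h \<in> borel_measurable ?L" using v h by auto
  define F where "F n t = soft_pos (shrinking 1 n) t - soft_pos (shrinking 1 n) (t - 1)" for n t
  define F' where "F' n t = soft_pos_deriv (shrinking 1 n) t - soft_pos_deriv (shrinking 1 n) (t - 1)" for n t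
  have sh: "0 < shrinking 1 n" "shrinking 1 \<longlonglongrightarrow> 0" for n using shrinking[of 1] by auto
  have dF: "(F n has_real_derivative F' n t) (at t)" for n t
  proof -
    have "((\<lambda>t. soft_pos (shrinking 1 n) (t - 1)) has_real_derivative soft_pos_deriv (shrinking 1 n) (t - 1) * 1) (at t)"
      by (rule DERIV_chain2[OF has_real_derivative_soft_pos[OF sh(1)]]) (auto intro!: derivative_eq_intros)
    from DERIV_diff[OF has_real_derivative_soft_pos[OF sh(1)] this] show ?thesis
      by (simp add: F_def[abs_def] F'_def)
  qed
  have cF': "continuous_on UNIV (F' n)" for n
    unfolding F'_def
    by (intro continuous_intros continuous_on_compose2[OF continuous_on_soft_pos_deriv[OF sh(1), of UNIV]]) auto
  \<comment> \<open>A difference of two numbers in \<open>[0, 1]\<close>. Since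
    \<open>F n 0 = 0\<close>, it also gives the bound on \<open>F n\<close> by the mean value
    theorem.\<close>
  have bF': "\<bar>F' n t\<bar> \<le> 1" for n t
    using soft_pos_deriv_bounds[OF sh(1), of n t] soft_pos_deriv_bounds[OF sh(1), of n "t - 1"]
    by (auto simp: F'_def)
  have bF: "\<bar>F n t\<bar> \<le> \<bar>t\<bar>" for n t
  proof -
    have "norm (F n t - F n 0) \<le> 1 * norm (t - 0)"
      by (rule field_differentiable_bound[where S = UNIV and f' = "F' n"]) (use dF bF' in auto)
    then show ?thesis by (simp add: F_def soft_pos_def)
  qed
  have [measurable]: "F' n \<in> borel_measurable borel" for n
    by (rule borel_measurable_continuous_onI[OF cF'])
  have [measurable]: "F n \<in> borel_measurable borel" for n
    using DERIV_isCont[OF dF] by (intro borel_measurable_continuous_onI continuous_at_imp_continuous_on) auto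
  have lF: "(\<lambda>n. F n t) \<longlonglongrightarrow> clamp01 t" for t
  proof -
    have "(\<lambda>n. F n t) \<longlonglongrightarrow> max 0 t - max 0 (t - 1)"
      unfolding F_def by (intro tendsto_diff tendsto_soft_pos sh)
    then show ?thesis by (simp add: clamp01_def max_def min_def split: if_splits)
  qed
  have lF': "(\<lambda>n. F' n t) \<longlonglongrightarrow> clamp01_deriv t" for t
  proof -
    have "(\<lambda>n. F' n t) \<longlonglongrightarrow> (if 0 < t then 1 else 0) - (if 0 < t - 1 then 1 else 0)"
      unfolding F'_def by (intro tendsto_diff tendsto_soft_pos sh)
    moreover have "(if 0 < t then 1 else 0) - (if 0 < t - 1 then 1 else 0) = clamp01_deriv t"
      by (auto simp: clamp01_deriv_def)
    ultimately show ?thesis by simp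
  qed
  have e1: "k (u x) * D x = k (v x) * D x" and e2: "k (u x) * (G x \<bullet> b) * \<phi> x = k (v x) * h x * \<phi> x" for k :: "real \<Rightarrow> real" and x
    using z[of x] by (cases "x \<in> K", auto simp: v_def h_def)+
  have parts: "(LINT x|?L. F n (v x) * D x) = - (LINT x|?L. F' n (v x) * h x * \<phi> x)" for n
    using weak_chain_rule[OF w \<Omega> dF cF' bF' \<phi> b] by (simp only: D_def[symmetric] e1 e2)
  have l1: "(\<lambda>n. LINT x|?L. F n (v x) * D x) \<longlonglongrightarrow> (LINT x|?L. clamp01 (v x) * D x)"
  proof (rule integral_dominated_convergence[where w = "\<lambda>x. \<bar>v x\<bar> * B"])
    show "integrable ?L (\<lambda>x. \<bar>v x\<bar> * B)" using v by auto
    show "AE x in ?L. norm (F n (v x) * D x) \<le> \<bar>v x\<bar> * B" for n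
      unfolding real_norm_def abs_mult by (intro AE_I2 mult_mono bF B) auto
    show "AE x in ?L. (\<lambda>n. F n (v x) * D x) \<longlonglongrightarrow> clamp01 (v x) * D x"
      by (intro AE_I2 tendsto_mult_right lF)
  qed measurable
  have l2: "(\<lambda>n. LINT x|?L. F' n (v x) * h x * \<phi> x) \<longlonglongrightarrow> (LINT x|?L. clamp01_deriv (v x) * h x * \<phi> x)"
  proof (rule integral_dominated_convergence[where w = "\<lambda>x. 1 * \<bar>h x\<bar> * B"])
    show "integrable ?L (\<lambda>x. 1 * \<bar>h x\<bar> * B)" using h by auto
    show "AE x in ?L. norm (F' n (v x) * h x * \<phi> x) \<le> 1 * \<bar>h x\<bar> * B" for n
      unfolding real_norm_def abs_mult by (intro AE_I2 mult_mono bF' B) auto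
    show "AE x in ?L. (\<lambda>n. F' n (v x) * h x * \<phi> x) \<longlonglongrightarrow> clamp01_deriv (v x) * h x * \<phi> x"
      by (intro AE_I2 tendsto_mult_right lF')
  qed measurable
  have "(LINT x|?L. clamp01 (v x) * D x) = - (LINT x|?L. clamp01_deriv (v x) * h x * \<phi> x)"
    using LIMSEQ_unique[OF l1] tendsto_minus[OF l2] by (simp add: parts)
  then show "(LINT x|?L. clamp01 (u x) * frechet_derivative \<phi> (at x) b)
      = - (LINT x|?L. ((clamp01_deriv (u x) *\<^sub>R G x) \<bullet> b) * \<phi> x)"
    by (simp only: D_def[symmetric] e1 e2 inner_scaleR_left)
qed

section \<open>Truncation in the Sobolev space and in the functional\<close>

lemma borel_measurable_lebesgue_on_AE:
  fixes f g :: "'a::euclidean_space \<Rightarrow> 'b::euclidean_space"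
  assumes S: "S \<in> sets lebesgue" and f: "f \<in> borel_measurable (lebesgue_on S)"
    and ae: "AE x in lebesgue_on S. f x = g x"
  shows "g \<in> borel_measurable (lebesgue_on S)"
proof -
  have "(\<lambda>x. indicator S x *\<^sub>R f x) \<in> borel_measurable lebesgue"
    using S f by (simp add: borel_measurable_restrict_space_iff)
  moreover have "AE x in lebesgue. indicator S x *\<^sub>R f x = indicator S x *\<^sub>R g x"
    using ae S by (auto simp: AE_restrict_space_iff indicator_def elim!: eventually_mono)
  ultimately have "(\<lambda>x. indicator S x *\<^sub>R g x) \<in> borel_measurable lebesgue"
    by (rule borel_measurable_AE)
  then show ?thesis using S by (simp add: borel_measurable_restrict_space_iff)
qed

lemma W1_var_weak_gradient:
  assumes "U \<in> W1_var \<Omega> p"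
  shows "has_weak_gradient \<Omega> U (weak_gradient \<Omega> U)"
proof -
  obtain G where "has_weak_gradient \<Omega> U G" using assms by (auto simp: W1_var_def)
  then show ?thesis
    unfolding weak_gradient_def by (rule someI[where P = "has_weak_gradient \<Omega> U"])
qed

text \<open>The explicit gradient shows that a weak gradient exists, so the chosen one is a weak
  gradient too, and uniqueness identifies them.\<close>

lemma weak_gradient_clamp01:
  fixes U :: "'a::euclidean_space \<Rightarrow> real"
  assumes U: "U \<in> W1_var \<Omega> p" and \<Omega>: "open \<Omega>"
  shows "AE x in lebesgue_on \<Omega>.
    clamp01_deriv (U x) *\<^sub>R weak_gradient \<Omega> U x = weak_gradient \<Omega> (\<lambda>x. clamp01 (U x)) x"
proof -
  note w = has_weak_gradient_clamp01[OF W1_var_weak_gradient[OF U] \<Omega>]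
  have "has_weak_gradient \<Omega> (\<lambda>x. clamp01 (U x)) (weak_gradient \<Omega> (\<lambda>x. clamp01 (U x)))"
    unfolding weak_gradient_def[of _ "\<lambda>x. clamp01 (U x)"]
    using w by (rule someI[where P = "has_weak_gradient \<Omega> (\<lambda>x. clamp01 (U x))"])
  from weak_gradient_unique[OF w this \<Omega>] show ?thesis .
qed

lemma L_var_mono:
  assumes u: "u \<in> L_var \<Omega> q" and v: "v \<in> borel_measurable (lebesgue_on \<Omega>)"
    and le: "AE x in lebesgue_on \<Omega>. \<bar>v x\<bar> \<le> \<bar>u x\<bar>" and q: "\<And>x. x \<in> \<Omega> \<Longrightarrow> 0 \<le> q x"
  shows "v \<in> L_var \<Omega> q"
proof -
  have "(\<integral>\<^sup>+x. ennreal (\<bar>v x\<bar> powr q x) \<partial>lebesgue_on \<Omega>) \<le> (\<integral>\<^sup>+x. ennreal (\<bar>u x\<bar> powr q x) \<partial>lebesgue_on \<Omega>)"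
  proof (rule nn_integral_mono_AE)
    show "AE x in lebesgue_on \<Omega>. ennreal (\<bar>v x\<bar> powr q x) \<le> ennreal (\<bar>u x\<bar> powr q x)"
      using le AE_space
      by eventually_elim (auto intro!: ennreal_leI powr_mono2 q simp: space_restrict_space)
  qed
  then show ?thesis
    using u v by (auto simp: L_var_def intro: order.strict_trans1)
qed

text \<open>Both the truncated function and the norm of its gradient are dominated almost everywhere
  by those of \<open>U\<close>, so they inherit membership in \<open>L_var\<close>.\<close>

lemma clamp01_in_X_set:
  fixes U :: "'a::euclidean_space \<Rightarrow> real"
  assumes U: "U \<in> W1_var \<Omega> p" and \<Omega>: "open \<Omega>" and p: "\<And>x. x \<in> \<Omega> \<Longrightarrow> 0 \<le> p x"
  shows "(\<lambda>x. clamp01 (U x)) \<in> X_set \<Omega> p"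
proof -
  let ?C = "\<lambda>x. clamp01 (U x)"
  have UL: "U \<in> L_var \<Omega> p" and GL: "(\<lambda>x. norm (weak_gradient \<Omega> U x)) \<in> L_var \<Omega> p"
    using U by (auto simp: W1_var_def)
  have [measurable]: "U \<in> borel_measurable (lebesgue_on \<Omega>)"
    "(\<lambda>x. norm (weak_gradient \<Omega> U x)) \<in> borel_measurable (lebesgue_on \<Omega>)"
    using UL GL by (auto simp: L_var_def)
  have C: "?C \<in> L_var \<Omega> p"
    by (rule L_var_mono[OF UL _ _ p]) (measurable, simp add: abs_clamp01_le)
  have ae: "AE x in lebesgue_on \<Omega>. clamp01_deriv (U x) * norm (weak_gradient \<Omega> U x) = norm (weak_gradient \<Omega> ?C x)"
    using weak_gradient_clamp01[OF U \<Omega>]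
  proof eventually_elim
    case (elim x)
    then show ?case by (simp add: clamp01_deriv_def flip: elim)
  qed
  \<comment> \<open>The chosen gradient of the truncation carries no measurability of its own; it
    inherits that of the explicit formula through almost everywhere equality.\<close>
  have "(\<lambda>x. norm (weak_gradient \<Omega> ?C x)) \<in> borel_measurable (lebesgue_on \<Omega>)"
    using \<Omega> by (intro borel_measurable_lebesgue_on_AE[OF _ _ ae]) auto
  moreover have "AE x in lebesgue_on \<Omega>. \<bar>norm (weak_gradient \<Omega> ?C x)\<bar> \<le> \<bar>norm (weak_gradient \<Omega> U x)\<bar>"
    using ae by eventually_elim (auto simp: clamp01_deriv_def split: if_splits)
  ultimately have "(\<lambda>x. norm (weak_gradient \<Omega> ?C x)) \<in> L_var \<Omega> p"
    by (rule L_var_mono[OF GL _ _ p])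
  moreover have "\<exists>G. has_weak_gradient \<Omega> ?C G"
    using has_weak_gradient_clamp01[OF W1_var_weak_gradient[OF U] \<Omega>] by blast
  ultimately show ?thesis
    using C by (auto simp: X_set_def W1_var_def clamp01_def)
qed

text \<open>The integral runs over the singleton \<open>{0}\<close>, a null set.\<close>

lemma A_fun_0: "A_fun \<Psi> x 0 = 0"
proof -
  have "AE s in lborel. indicator {0 .. norm (0 :: 'a)} s *\<^sub>R Phi \<Psi> x s = 0"
    using AE_lborel_singleton[of "0 :: real"] by eventually_elim (auto simp: indicator_def)
  then show ?thesis
    unfolding A_fun_def set_lebesgue_integral_def
    by (rule integral_eq_zero_AE)
qed

text \<open>Where the factor \<open>clamp01_deriv (U x)\<close> is 1 the integrand is unchanged;
  where it is 0 the new integrand is zero, the least value in \<open>ennreal\<close>.\<close>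

lemma grad_energy_clamp01_le:
  fixes U :: "'a::euclidean_space \<Rightarrow> real"
  assumes U: "U \<in> W1_var \<Omega> p" and \<Omega>: "open \<Omega>"
  shows "grad_energy \<Omega> \<Psi> (\<lambda>x. clamp01 (U x)) \<le> grad_energy \<Omega> \<Psi> U"
proof -
  have "AE x in lebesgue_on \<Omega>. ennreal (A_fun \<Psi> x (weak_gradient \<Omega> (\<lambda>x. clamp01 (U x)) x))
      \<le> ennreal (A_fun \<Psi> x (weak_gradient \<Omega> U x))"
    using weak_gradient_clamp01[OF U \<Omega>]
  proof eventually_elim
    case (elim x)
    then show ?case by (simp add: clamp01_deriv_def A_fun_0 flip: elim)
  qed
  then show ?thesis
    unfolding grad_energy_def by (simp add: less_eq_ennreal.rep_eq[symmetric] nn_integral_mono_AE)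
qed

lemma clamp01_quadratic_le:
  assumes "0 \<le> c" "c \<le> l"
  shows "l / 2 * (clamp01 t)\<^sup>2 - c * clamp01 t \<le> l / 2 * t\<^sup>2 - c * t"
proof -
  consider "t < 0" | "0 \<le> t" "t \<le> 1" | "1 < t" by linarith
  then show ?thesis
  proof cases
    case 1
    then have "0 \<le> l / 2 * t\<^sup>2" "0 \<le> - (c * t)"
      using assms by (auto simp: mult_nonneg_nonpos)
    then show ?thesis using 1 by (simp add: clamp01_def)
  next
    case 2
    then show ?thesis by (simp add: clamp01_def)
  next
    case 3
    \<comment> \<open>The increase of the parabola from 1 to \<open>t\<close> is nonnegative:
      \<open>c \<le> l\<close> compares the slopes, and \<open>(t + 1) / 2 \<ge> 1\<close> absorbs
      the factor one half.\<close>
    have "c * (t - 1) \<le> l / 2 * ((t - 1) * (t + 1))"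
    proof -
      have "c * (t - 1) \<le> l * (t - 1)" using 3 assms by (intro mult_right_mono) auto
      also have "\<dots> \<le> l * (t - 1) * ((t + 1) / 2)"
        using mult_left_mono[of 1 "(t + 1) / 2" "l * (t - 1)"] 3 assms by simp
      finally show ?thesis by (simp add: algebra_simps)
    qed
    then show ?thesis using 3 by (simp add: clamp01_def power2_eq_square algebra_simps)
  qed
qed

lemma J_fun_clamp01_le:
  fixes U :: "'a::euclidean_space \<Rightarrow> real"
  assumes U: "U \<in> W1_var \<Omega> p" and \<Omega>: "open \<Omega>" "bounded \<Omega>" and lam: "0 < lam"
    and g: "g \<in> borel_measurable (lebesgue_on \<Omega>)" "AE x in lebesgue_on \<Omega>. 0 \<le> g x \<and> g x \<le> lam"
  shows "J_fun \<Omega> \<Psi> lam g (\<lambda>x. clamp01 (U x)) \<le> J_fun \<Omega> \<Psi> lam g U"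
proof (cases "(\<integral>\<^sup>+x. ennreal ((U x)\<^sup>2) \<partial>lebesgue_on \<Omega>) = \<infinity>")
  case True
  have "0 \<le> grad_energy \<Omega> \<Psi> U" by (simp add: grad_energy_def)
  then have "grad_energy \<Omega> \<Psi> U \<noteq> - \<infinity>" by auto
  then have "J_fun \<Omega> \<Psi> lam g U = \<infinity>"
    using lam by (simp add: J_fun_def True)
  then show ?thesis by simp
next
  case False
  let ?L = "lebesgue_on \<Omega>"
  have U_meas [measurable]: "U \<in> borel_measurable ?L"
    using U by (auto simp: W1_var_def L_var_def)
  note [measurable] = g(1)
  have fin: "finite_measure ?L"
    using \<Omega> by (intro finite_measure_lebesgue_on lmeasurable_open)
  have one: "integrable ?L (\<lambda>_. 1 :: real)"
    using fin by (simp add: finite_measure.integrable_const)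
  have sq: "integrable ?L (\<lambda>x. (U x)\<^sup>2)"
    using False by (intro integrableI_bounded) (auto simp: less_top)
  \<comment> \<open>Proved for any \<open>W\<close> dominated by \<open>U\<close>, so that it covers
    both \<open>U\<close> and its truncation. The lower order terms become a single real integral,
    to which the pointwise inequality applies, while the gradient term stays in
    \<open>ereal\<close>.\<close>
  have quad: "J_fun \<Omega> \<Psi> lam g W = grad_energy \<Omega> \<Psi> W + ereal (LINT x|?L. lam / 2 * (W x)\<^sup>2 - g x * W x)"
    and iq: "integrable ?L (\<lambda>x. lam / 2 * (W x)\<^sup>2 - g x * W x)"
    if W: "W \<in> borel_measurable ?L" "\<And>x. \<bar>W x\<bar> \<le> \<bar>U x\<bar>" for W
  proof -
    note [measurable] = W(1)
    have Wsq: "integrable ?L (\<lambda>x. (W x)\<^sup>2)"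
    proof (rule Bochner_Integration.integrable_bound[OF sq])
      show "AE x in ?L. norm ((W x)\<^sup>2) \<le> norm ((U x)\<^sup>2)"
        using W(2) by (simp add: abs_le_square_iff)
    qed measurable
    have gW: "integrable ?L (\<lambda>x. g x * W x)"
    proof (rule Bochner_Integration.integrable_bound)
      \<comment> \<open>A linear term is controlled by the square plus a constant, and constants are
        integrable because \<open>\<Omega>\<close> is bounded.\<close>
      show "integrable ?L (\<lambda>x. lam * (1 + (W x)\<^sup>2))" using one Wsq by auto
      show "AE x in ?L. norm (g x * W x) \<le> norm (lam * (1 + (W x)\<^sup>2))"
        using g(2)
      proof eventually_elim
        case (elim x)
        have "\<bar>W x\<bar> \<le> 1 + (W x)\<^sup>2"
          using zero_le_power2[of "\<bar>W x\<bar> - 1 / 2"] by (simp add: power2_diff power_divide)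
        then have "\<bar>g x\<bar> * \<bar>W x\<bar> \<le> lam * (1 + (W x)\<^sup>2)"
          using elim by (intro mult_mono) auto
        then show ?case using lam by (simp add: abs_mult)
      qed
    qed measurable
    show "integrable ?L (\<lambda>x. lam / 2 * (W x)\<^sup>2 - g x * W x)" using Wsq gW by auto
    have "(\<integral>\<^sup>+x. ennreal ((W x)\<^sup>2) \<partial>?L) = ennreal (LINT x|?L. (W x)\<^sup>2)"
      using Wsq by (intro nn_integral_eq_integral) auto
    then show "J_fun \<Omega> \<Psi> lam g W = grad_energy \<Omega> \<Psi> W + ereal (LINT x|?L. lam / 2 * (W x)\<^sup>2 - g x * W x)"
      using Wsq gW unfolding J_fun_def
      by (cases "grad_energy \<Omega> \<Psi> W") (simp_all add: enn2ereal_ennreal integral_nonneg_AE)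
  qed
  have CU: "\<bar>clamp01 (U x)\<bar> \<le> \<bar>U x\<bar>" for x by (rule abs_clamp01_le)
  have C: "(\<lambda>x. clamp01 (U x)) \<in> borel_measurable ?L" by measurable
  have "(LINT x|?L. lam / 2 * (clamp01 (U x))\<^sup>2 - g x * clamp01 (U x)) \<le> (LINT x|?L. lam / 2 * (U x)\<^sup>2 - g x * U x)"
  proof (rule integral_mono_AE[OF iq[OF C CU] iq[OF U_meas]])
    show "AE x in ?L. lam / 2 * (clamp01 (U x))\<^sup>2 - g x * clamp01 (U x) \<le> lam / 2 * (U x)\<^sup>2 - g x * U x"
      using g(2) by eventually_elim (rule clamp01_quadratic_le; simp)
  qed simp
  then show ?thesis
    unfolding quad[OF C CU] quad[OF U_meas order_refl]
    by (intro add_mono grad_energy_clamp01_le[OF U \<Omega>(1)]) simp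
qed

theorem lemma6p2:
  fixes \<Omega> :: "(real^'n) set"
    and p :: "real^'n \<Rightarrow> real"
    and \<Psi> :: "real^'n \<Rightarrow> real \<Rightarrow> real"
    and lam :: real
    and g V :: "real^'n \<Rightarrow> real"
  assumes dim: "CARD('n) \<ge> 2"
    and dom: "bounded_lipschitz_domain \<Omega>"
    and p_gt_1: "\<And>x. x \<in> closure \<Omega> \<Longrightarrow> 1 < p x"
    and p_reg:
      "(log_holder_on (closure \<Omega>) p \<and>
          (INF x\<in>closure \<Omega>. p x) \<ge> 2 * real CARD('n) / (real CARD('n) + 2)) \<or>
       (continuous_on (closure \<Omega>) p \<and>
          (INF x\<in>closure \<Omega>. p x) > 2 * real CARD('n) / (real CARD('n) + 2))"
    and Psi_pos: "\<And>x s. x \<in> closure \<Omega> \<Longrightarrow> 0 < s \<Longrightarrow> 0 < \<Psi> x s"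
    and Psi_meas: "\<And>s. 0 < s \<Longrightarrow> (\<lambda>x. \<Psi> x s) \<in> borel_measurable (lebesgue_on (closure \<Omega>))"
    and Psi_ac: "AE x in lebesgue_on \<Omega>. locally_absolutely_continuous_on {0<..} (\<Psi> x)"
    and Psi_lim: "\<And>x. x \<in> \<Omega> \<Longrightarrow> ((\<lambda>s. \<Psi> x s * s) \<longlongrightarrow> 0) (at_right 0)"
    and Psi_mono: "AE x in lebesgue_on \<Omega>. strict_mono_on {0<..} (\<lambda>s. \<Psi> x s * s)"
    and Phi_dual: "\<And>v. v \<in> L_var \<Omega> p \<Longrightarrow>
      (\<lambda>x. Phi \<Psi> x (v x)) \<in> L_var \<Omega> (\<lambda>x. p x / (p x - 1))"
    and coercive: "\<exists>\<delta>>0. \<exists>\<delta>'\<ge>0. \<forall>v\<in>W1_var \<Omega> p.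
      grad_energy \<Omega> \<Psi> v \<ge>
        ereal \<delta> * enn2ereal (\<integral>\<^sup>+x. ennreal (norm (weak_gradient \<Omega> v x) powr p x) \<partial>lebesgue_on \<Omega>)
        - ereal \<delta>'"
    and lam_pos: "0 < lam"
    and g_Linf: "g \<in> L_infty \<Omega>"
    and g_bounds: "AE x in lebesgue_on \<Omega>. 0 \<le> g x \<and> g x \<le> lam"
    and V_in: "V \<in> X_set \<Omega> p"
    and V_min: "\<And>U. U \<in> X_set \<Omega> p \<Longrightarrow> J_fun \<Omega> \<Psi> lam g V \<le> J_fun \<Omega> \<Psi> lam g U"
  shows "(INF U\<in>X_set \<Omega> p. J_fun \<Omega> \<Psi> lam g U) = J_fun \<Omega> \<Psi> lam g V \<and>
         J_fun \<Omega> \<Psi> lam g V = (INF U\<in>W1_var \<Omega> p. J_fun \<Omega> \<Psi> lam g U)"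
proof
  show "(INF U\<in>X_set \<Omega> p. J_fun \<Omega> \<Psi> lam g U) = J_fun \<Omega> \<Psi> lam g V"
    by (intro antisym INF_lower INF_greatest V_in V_min)
  have \<Omega>: "open \<Omega>" "bounded \<Omega>"
    using dom by (auto simp: bounded_lipschitz_domain_def)
  have p0: "0 \<le> p x" if "x \<in> \<Omega>" for x
    using p_gt_1[of x] that closure_subset[of \<Omega>] by force
  have g: "g \<in> borel_measurable (lebesgue_on \<Omega>)"
    using g_Linf by (simp add: L_infty_def)
  have "V \<in> W1_var \<Omega> p"
    using V_in by (simp add: X_set_def)
  moreover have "J_fun \<Omega> \<Psi> lam g V \<le> J_fun \<Omega> \<Psi> lam g U" if U: "U \<in> W1_var \<Omega> p" for U
    using V_min[OF clamp01_in_X_set[OF U \<Omega>(1) p0]] J_fun_clamp01_le[OF U \<Omega> lam_pos g g_bounds]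
    by (rule order_trans)
  ultimately show "J_fun \<Omega> \<Psi> lam g V = (INF U\<in>W1_var \<Omega> p. J_fun \<Omega> \<Psi> lam g U)"
    by (intro antisym INF_lower INF_greatest)
qed

end
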